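(* Let $G$ be a unicycle graph of order $n$ with cycle $C_m$, and let $Y=\{v\in V(C_m)\mid G-v \text{ is connected}\}$. Then: if $G=C_4$, then $CC(G)=4$; if $G\in\mathcal{G}$, then $CC(G)=0$; if $G\notin\mathcal{G}$, $n\geq 5$, and either $|Y|\leq 1$ or $G[Y]=K_2$, then $CC(G)=2$; in all other cases, $CC(G)=3$.
   Context: All graphs are finite and simple. A unicycle graph is a connected graph containing exactly one cycle; $C_m$ denotes that cycle (of length $m\ge 3$). $\mathcal{G}$ is the family of graphs obtained by identifying a vertex of $K_3$ with the full vertex (centre) of a star graph $K_{1,k}$, $k\geq 1$. $G[Y]$ denotes the induced subgraph on $Y$. A full vertex of $G$ is a vertex of degree $|V(G)|-1$. A set $S\subseteq V(G)$ is a dominating set of $G$ if every vertex of $V(G)\setminus S$ has a neighbour in $S$; it is a connected dominating set if moreover $G[S]$ is connected. Two disjoint vertex sets $A_1,A_2$ form a connected coalition of $G$ if $A_1\cup A_2$ is a connected dominating set of $G$ but neither $A_1$ nor $A_2$ is a connected dominating set of $G$. A connected coalition partition of $G$ is a partition $\Phi$ of $V(G)$ (into nonempty sets) such that each $A\in\Phi$ either is $\{v\}$ for some full vertex $v$ of $G$, or forms a connected coalition of $G$ with another set in $\Phi$. The connected coalition number $CC(G)$ is the maximum cardinality of a connected coalition partition of $G$, with $CC(G)=0$ if none exists. *)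

theory Defs
  imports "Graph_Theory.Graph_Theory" "HOL-Library.Disjoint_Sets"
begin

text \<open>
  A finite simple graph is a \<^locale>\<open>pair_graph\<close>: a finite, symmetric, loop-free digraph without
  parallel arcs, in which an edge \<open>uv\<close> is the pair of arcs \<open>(u,v)\<close> and \<open>(v,u)\<close>.
  \<^const>\<open>connected\<close> requires at least one vertex.
\<close>

text \<open>
  The graph \<open>C\<^sub>m\<close>. The library's \<^const>\<open>pre_digraph.cycle\<close> is not used because in a symmetric
  digraph it also admits \<open>u, v, u\<close> and counts every traversal of an undirected cycle separately.
\<close>

definition cycle_graph :: "nat \<Rightarrow> 'a pair_pre_digraph \<Rightarrow> bool" where
  "cycle_graph m C \<longleftrightarrow> m \<ge> 3 \<and>
     (\<exists>vs. distinct vs \<and> length vs = m \<and> pverts C = set vs \<and>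
       parcs C = (\<Union>i<m. {(vs ! i, vs ! (Suc i mod m)), (vs ! (Suc i mod m), vs ! i)}))"

definition cycle_of :: "nat \<Rightarrow> 'a pair_pre_digraph \<Rightarrow> 'a pair_pre_digraph \<Rightarrow> bool" where
  "cycle_of m C G \<longleftrightarrow> cycle_graph m C \<and> subgraph (with_proj C) (with_proj G)"

definition unicycle_graph :: "'a pair_pre_digraph \<Rightarrow> bool" where
  "unicycle_graph G \<longleftrightarrow>
     pair_graph G \<and> connected (with_proj G) \<and> (\<exists>!C. \<exists>m. cycle_of m C G)"

text \<open>In a symmetric digraph the out-degree is the degree of the undirected graph.\<close>

definition full_vertex :: "'a pair_pre_digraph \<Rightarrow> 'a \<Rightarrow> bool" where
  "full_vertex G v \<longleftrightarrow> v \<in> pverts G \<and> out_degree (with_proj G) v = card (pverts G) - 1"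

text \<open>
  The family \<open>\<G>\<close>: identifying a vertex of \<open>K\<^sub>3\<close> with a full vertex \<open>c\<close> of a star amounts to
  \<open>G\<close> being the union of a triangle and a star that have exactly the vertex \<open>c\<close> in common.
\<close>

definition triangle_star :: "'a pair_pre_digraph \<Rightarrow> bool" where
  "triangle_star G \<longleftrightarrow>
     (\<exists>k T S c. k \<ge> 1 \<and> complete_digraph 3 (with_proj T) \<and>
        complete_bipartite_digraph 1 k (with_proj S) \<and> full_vertex S c \<and>
        pverts T \<inter> pverts S = {c} \<and> with_proj G = union (with_proj T) (with_proj S))"

definition dominating_set :: "'a pair_pre_digraph \<Rightarrow> 'a set \<Rightarrow> bool" where
  "dominating_set G S \<longleftrightarrow>
     S \<subseteq> pverts G \<and> (\<forall>v \<in> pverts G - S. \<exists>u \<in> S. (u, v) \<in> parcs G)"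

definition connected_dominating_set :: "'a pair_pre_digraph \<Rightarrow> 'a set \<Rightarrow> bool" where
  "connected_dominating_set G S \<longleftrightarrow> dominating_set G S \<and> connected (with_proj G \<restriction> S)"

definition connected_coalition :: "'a pair_pre_digraph \<Rightarrow> 'a set \<Rightarrow> 'a set \<Rightarrow> bool" where
  "connected_coalition G A B \<longleftrightarrow>
     A \<subseteq> pverts G \<and> B \<subseteq> pverts G \<and> A \<inter> B = {} \<and>
     connected_dominating_set G (A \<union> B) \<and>
     \<not> connected_dominating_set G A \<and> \<not> connected_dominating_set G B"

definition connected_coalition_partition :: "'a pair_pre_digraph \<Rightarrow> 'a set set \<Rightarrow> bool" where
  "connected_coalition_partition G \<Phi> \<longleftrightarrow> partition_on (pverts G) \<Phi> \<and>
     (\<forall>A \<in> \<Phi>. (\<exists>v. full_vertex G v \<and> A = {v}) \<or> (\<exists>B \<in> \<Phi> - {A}. connected_coalition G A B))"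

definition CC :: "'a pair_pre_digraph \<Rightarrow> nat" where
  "CC G = (if \<exists>\<Phi>. connected_coalition_partition G \<Phi>
           then Max (card ` {\<Phi>. connected_coalition_partition G \<Phi>}) else 0)"

end

theory Submission
  imports Defs
begin

text \<open>
  Write \<open>X\<close> for the set of cut vertices and call a vertex set small if it has at most two elements and
  these are pairwise adjacent. A non-cut vertex with two neighbours lies, together with these
  neighbours, on \<open>C\<^sub>m\<close>, because the neighbours are joined by a path avoiding the vertex and the cycle
  is unique. It follows that a nonempty \<open>S\<close> is a connected dominating set iff \<open>X \<subseteq> S\<close> and \<open>Y - S\<close> is
  small.

  If \<open>Y\<close> is small, the connected dominating sets are thus the supersets of \<open>X\<close>. For \<open>\<bar>X\<bar> \<le> 1\<close> the graph
  lies in \<open>\<G>\<close>, where the centre is contained in every connected dominating set and is one on its own;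
  otherwise \<open>X\<close> has to be split between exactly two parts. If \<open>Y\<close> is not small, then apart from
  \<open>K\<^sub>3\<close> there are nonadjacent \<open>a, b \<in> Y\<close>, which give the partition into \<open>{a}\<close>, \<open>{b}\<close> and the rest.
  In a partition with four parts, except on \<open>C\<^sub>4\<close>, a single part \<open>A\<close> is the partner of all others;
  every other part meets \<open>Y\<close>, and picking one vertex of \<open>Y\<close> in each of three of them yields a
  triangle, which has to be the cycle and then the whole graph.
\<close>

section \<open>Connected vertex sets\<close>

text \<open>Connectivity of the subgraph induced by \<open>S\<close>, expressed by walks that stay
  in \<open>S\<close>, so that no subgraph has to be formed. Nonemptiness mirrors the convention of
  \<open>connected\<close>.\<close>

definition conn :: "'a pair_pre_digraph \<Rightarrow> 'a set \<Rightarrow> bool" where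
  "conn G S \<longleftrightarrow> S \<noteq> {} \<and> S \<times> S \<subseteq> rtrancl_on S (parcs G)"

lemma connD: "conn G S \<Longrightarrow> u \<in> S \<Longrightarrow> v \<in> S \<Longrightarrow> (u, v) \<in> rtrancl_on S (parcs G)"
  unfolding conn_def by blast

lemma rtrancl_on_restrict: "rtrancl_on S {e \<in> R. fst e \<in> S \<and> snd e \<in> S} = rtrancl_on S R"
proof -
  have "(u, v) \<in> rtrancl_on S {e \<in> R. fst e \<in> S \<and> snd e \<in> S}" if "(u, v) \<in> rtrancl_on S R" for u v
    using that
  proof (induct rule: rtrancl_on_induct)
    case (step y z)
    then show ?case by (intro rtrancl_on_into_rtrancl_on[OF step(5)]) auto
  qed auto
  moreover have "(u, v) \<in> rtrancl_on S R" if "(u, v) \<in> rtrancl_on S {e \<in> R. fst e \<in> S \<and> snd e \<in> S}" for u v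
    by (rule rtrancl_on_mono[OF _ _ that]) auto
  ultimately show ?thesis by auto
qed

text \<open>\<open>connected\<close> asks for strong connectivity of the symmetric closure; the arcs
  of \<open>G\<close> are already symmetric, so the closure adds nothing.\<close>

lemma (in pair_graph) connected_induce_iff: "connected (with_proj G \<restriction> S) \<longleftrightarrow> conn G S"
proof -
  have "parcs (mk_symmetric (with_proj G \<restriction> S)) = {e \<in> parcs G. fst e \<in> S \<and> snd e \<in> S}"
    using arcs_symmetric by (auto simp: parcs_mk_symmetric)
  then show ?thesis
    by (auto simp: connected_def strongly_connected_def reachable_def conn_def rtrancl_on_restrict)
qed

lemma (in pair_graph) connected_iff: "connected (with_proj G) \<longleftrightarrow> conn G (pverts G)"
proof -
  have "with_proj G \<restriction> pverts G = with_proj G"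
    using wellformed' by (auto simp: induce_subgraph_def with_proj_def)
  then show ?thesis using connected_induce_iff[of "pverts G"] by simp
qed

lemma (in pair_graph) connected_del_vert_iff:
  "connected (pre_digraph.del_vert (with_proj G) v) \<longleftrightarrow> conn G (pverts G - {v})"
proof -
  have "with_proj G \<restriction> (pverts G - {v}) = pre_digraph.del_vert (with_proj G) v"
    using wellformed' by (auto simp: induce_subgraph_def with_proj_def pre_digraph.del_vert_def)
  then show ?thesis using connected_induce_iff[of "pverts G - {v}"] by simp
qed

lemma (in pair_graph) complete_2_induce_iff:
  assumes "S \<subseteq> pverts G"
  shows "complete_digraph 2 (with_proj G \<restriction> S) \<longleftrightarrow>
    card S = 2 \<and> (\<forall>a\<in>S. \<forall>b\<in>S. a \<noteq> b \<longrightarrow> (a, b) \<in> parcs G)"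
proof -
  let ?H = "\<lparr>pverts = S, parcs = {e \<in> parcs G. fst e \<in> S \<and> snd e \<in> S}\<rparr>"
  have "with_proj G \<restriction> S = with_proj ?H"
    by (auto simp: induce_subgraph_def with_proj_def)
  then have "complete_digraph 2 (with_proj G \<restriction> S) \<longleftrightarrow> complete_digraph 2 (with_proj ?H)" by (rule arg_cong)
  also have "\<dots> \<longleftrightarrow> card S = 2 \<and>
      {e \<in> parcs G. fst e \<in> S \<and> snd e \<in> S} = {(u, v). (u, v) \<in> S \<times> S \<and> u \<noteq> v}"
    using finite_subset[OF assms pair_finite_verts] by (simp add: complete_digraph_pair_def)
  also have "{e \<in> parcs G. fst e \<in> S \<and> snd e \<in> S} = {(u, v). (u, v) \<in> S \<times> S \<and> u \<noteq> v} \<longleftrightarrow>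
      (\<forall>a\<in>S. \<forall>b\<in>S. a \<noteq> b \<longrightarrow> (a, b) \<in> parcs G)"
    by (auto simp: set_eq_iff dest: no_loops')
  finally show ?thesis .
qed

lemma (in pair_graph) full_vertex_iff:
  "full_vertex G v \<longleftrightarrow> v \<in> pverts G \<and> (\<forall>u\<in>pverts G - {v}. (v, u) \<in> parcs G)"
proof (cases "v \<in> pverts G")
  case True
  let ?N = "{u. (v, u) \<in> parcs G}"
  have "out_arcs (with_proj G) v = Pair v ` ?N" by (auto simp: out_arcs_def)
  then have deg: "out_degree (with_proj G) v = card ?N"
    by (simp add: out_degree_def card_image inj_on_def)
  have sub: "?N \<subseteq> pverts G - {v}" by (auto dest: in_arcsD2 no_loops')
  have fin: "finite (pverts G - {v})" using pair_finite_verts by simp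
  have "card (pverts G - {v}) = card (pverts G) - 1" using True by simp
  \<comment> \<open>The out-neighbours form a subset of the finite set
    \<open>pverts G - {v}\<close>, so equal cardinality means equal sets.\<close>
  then have "card ?N = card (pverts G) - 1 \<longleftrightarrow> ?N = pverts G - {v}"
    using card_subset_eq[OF fin sub] by argo
  also have "\<dots> \<longleftrightarrow> (\<forall>u\<in>pverts G - {v}. (v, u) \<in> parcs G)" using sub by auto
  finally show ?thesis using True deg by (simp add: full_vertex_def)
qed (simp add: full_vertex_def)

section \<open>Paths inside a vertex set\<close>

lemma rtrancl_on_distinct_path:
  assumes "(u, w) \<in> rtrancl_on S R"
  shows "\<exists>p. p \<noteq> [] \<and> hd p = u \<and> last p = w \<and> distinct p \<and> set p \<subseteq> S \<and>
    successively (\<lambda>x y. (x, y) \<in> R) p"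
  using assms
proof (induct rule: converse_rtrancl_on_induct)
  case base
  then show ?case by (intro exI[of _ "[w]"]) auto
next
  case (step x y)
  then obtain p where p: "p \<noteq> []" "hd p = y" "last p = w" "distinct p" "set p \<subseteq> S"
    "successively (\<lambda>x y. (x, y) \<in> R) p" by blast
  show ?case
  proof (cases "x \<in> set p")
    case True
    \<comment> \<open>If the path already visits \<open>x\<close>, its segment before
      \<open>x\<close> is dropped, which keeps it distinct.\<close>
    then obtain p1 p2 where "p = p1 @ x # p2" by (auto simp: in_set_conv_decomp)
    then show ?thesis using p
      by (intro exI[of _ "x # p2"]) (auto simp: successively_append_iff)
  next
    case False
    then show ?thesis using p step(1,3)
      by (intro exI[of _ "x # p"]) (auto simp: successively_Cons)
  qed
qed

text \<open>The two neighbours are the predecessor and the successor of \<open>v\<close> on the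
  path; distinctness separates them, and symmetry of \<open>R\<close> reverses the arc from the
  predecessor.\<close>

lemma path_interior:
  assumes "successively (\<lambda>x y. (x, y) \<in> R) p" "distinct p" "sym R" "v \<in> set p" "v \<noteq> hd p" "v \<noteq> last p"
  shows "\<exists>u w. u \<in> set p \<and> w \<in> set p \<and> u \<noteq> w \<and> (v, u) \<in> R \<and> (v, w) \<in> R"
proof -
  obtain p1 p2 where p: "p = p1 @ v # p2" using assms(4) by (auto simp: in_set_conv_decomp)
  with assms(5,6) have ne: "p1 \<noteq> []" "p2 \<noteq> []" by auto
  have "(last p1, v) \<in> R" "(v, hd p2) \<in> R"
    using assms(1) ne unfolding p by (auto simp: successively_append_iff successively_Cons)
  then have "(v, last p1) \<in> R" "(v, hd p2) \<in> R" using symD[OF assms(3)] by simp_all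
  moreover have "last p1 \<in> set p1" "hd p2 \<in> set p2" using ne by auto
  ultimately show ?thesis
    using assms(2) unfolding p by (intro exI[of _ "last p1"] exI[of _ "hd p2"]) auto
qed

lemma rtrancl_on_exit:
  assumes "(u, w) \<in> rtrancl_on S R" "u \<in> A" "w \<notin> A"
  shows "\<exists>x\<in>A. \<exists>y\<in>S - A. (x, y) \<in> R"
  using assms by (induct rule: rtrancl_on_induct) auto

context pair_graph
begin

lemma rtrancl_on_graph_sym: "(u, v) \<in> rtrancl_on S (parcs G) \<Longrightarrow> (v, u) \<in> rtrancl_on S (parcs G)"
  using rtrancl_on_sym[of "parcs G" S] sym_arcs unfolding symmetric_def by (auto dest: symD)

text \<open>Any two vertices are joined by a walk through the hub \<open>z\<close>.\<close>

lemma conn_star: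
  assumes "z \<in> S" "\<And>u. u \<in> S \<Longrightarrow> u \<noteq> z \<Longrightarrow> (u, z) \<in> parcs G"
  shows "conn G S"
proof -
  have "(u, z) \<in> rtrancl_on S (parcs G)" if "u \<in> S" for u
    using that assms by (cases "u = z") (auto intro: rtrancl_on_into_rtrancl_on)
  then show ?thesis
    using assms(1) rtrancl_on_graph_sym unfolding conn_def by (blast intro: rtrancl_on_trans)
qed

text \<open>A vertex \<open>z\<close> of \<open>S\<close> serves as meeting point: a new vertex
  first steps into \<open>S\<close> and then walks to \<open>z\<close>.\<close>

lemma conn_superset:
  assumes "conn G S" "S \<subseteq> T" "\<And>v. v \<in> T - S \<Longrightarrow> \<exists>u\<in>S. (u, v) \<in> parcs G"
  shows "conn G T"
proof -
  obtain z where z: "z \<in> S" using assms(1) unfolding conn_def by auto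
  have S: "(u, z) \<in> rtrancl_on T (parcs G)" if "u \<in> S" for u
    using rtrancl_on_mono[OF order_refl assms(2) connD[OF assms(1) that z]] .
  have "(u, z) \<in> rtrancl_on T (parcs G)" if "u \<in> T" for u
  proof (cases "u \<in> S")
    case False
    with that obtain x where x: "x \<in> S" "(x, u) \<in> parcs G" using assms(3) by blast
    from converse_rtrancl_on_into_rtrancl_on[OF arcs_symmetric[OF x(2)] S[OF x(1)] that]
    show ?thesis .
  qed (rule S)
  then show ?thesis
    using z assms(2) rtrancl_on_graph_sym unfolding conn_def by (blast intro: rtrancl_on_trans)
qed

section \<open>Connected dominating sets and cut vertices\<close>

lemma cds_iff:
  "connected_dominating_set G S \<longleftrightarrow>
    S \<subseteq> pverts G \<and> (\<forall>v \<in> pverts G - S. \<exists>u \<in> S. (u, v) \<in> parcs G) \<and> conn G S"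
  by (auto simp: connected_dominating_set_def dominating_set_def connected_induce_iff)

lemma cds_superset:
  assumes "connected_dominating_set G S" "S \<subseteq> T" "T \<subseteq> pverts G"
  shows "connected_dominating_set G T"
  using assms conn_superset[of S T] unfolding cds_iff by blast

text \<open>A single vertex is connected, so only domination matters. Through this, the clause on
  full vertices in a coalition partition becomes a matter of connected dominating sets.\<close>

lemma full_vertex_iff_cds: "full_vertex G v \<longleftrightarrow> connected_dominating_set G {v}"
  unfolding full_vertex_iff cds_iff using conn_star[of v "{v}"] by auto

definition cut_vertices :: "'a set" where
  "cut_vertices = {v \<in> pverts G. \<not> conn G (pverts G - {v})}"

text \<open>If \<open>x\<close> is missing from \<open>S\<close>, then every other vertex is in
  \<open>S\<close> or attached to it, so the graph stays connected without \<open>x\<close>.\<close>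

lemma cut_vertices_subset_cds:
  assumes "connected_dominating_set G S"
  shows "cut_vertices \<subseteq> S"
proof
  fix x assume x: "x \<in> cut_vertices"
  show "x \<in> S"
  proof (rule ccontr)
    assume "x \<notin> S"
    with assms have "conn G S" "S \<subseteq> pverts G - {x}"
      and "\<And>v. v \<in> (pverts G - {x}) - S \<Longrightarrow> \<exists>u\<in>S. (u, v) \<in> parcs G"
      unfolding cds_iff by blast+
    then have "conn G (pverts G - {x})" by (rule conn_superset)
    with x show False unfolding cut_vertices_def by simp
  qed
qed

end

lemma cycle_graph_props:
  assumes "cycle_graph m C"
  shows "card (pverts C) = m" "m \<ge> 3" "parcs C \<subseteq> pverts C \<times> pverts C"
    "\<And>v. v \<in> pverts C \<Longrightarrow> \<exists>u w. u \<noteq> w \<and> {z. (v, z) \<in> parcs C} = {u, w}"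
proof -
  from assms obtain vs where vs: "m \<ge> 3" "distinct vs" "length vs = m" "pverts C = set vs"
    "parcs C = (\<Union>i<m. {(vs ! i, vs ! (Suc i mod m)), (vs ! (Suc i mod m), vs ! i)})"
    unfolding cycle_graph_def by blast
  show "card (pverts C) = m" "m \<ge> 3" using vs by (auto simp: distinct_card)
  have "vs ! i \<in> set vs" "vs ! (Suc i mod m) \<in> set vs" if "i < m" for i
    using that vs(1,3) by simp_all
  then show "parcs C \<subseteq> pverts C \<times> pverts C" unfolding vs(4,5) by blast
  fix v assume "v \<in> pverts C"
  then obtain i where i: "i < m" "v = vs ! i" using vs by (auto simp: in_set_conv_nth)
  \<comment> \<open>The cyclic successor and predecessor of position \<open>i\<close>; the
    predecessor of 0 wraps around to \<open>m - 1\<close>.\<close>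
  let ?s = "Suc i mod m" and ?p = "if i = 0 then m - 1 else i - 1"
  have inj: "vs ! a = vs ! b \<longleftrightarrow> a = b" if "a < m" "b < m" for a b
    using that vs nth_eq_iff_index_eq by blast
  have lt: "?s < m" "?p < m" using i(1) vs(1) by auto
  have sj: "Suc j mod m = i \<longleftrightarrow> j = ?p" if "j < m" for j
    using that i(1) vs(1) by (cases "Suc j = m") auto
  \<comment> \<open>This is where \<open>m \<ge> 3\<close> enters: for length two the successor and
    the predecessor would coincide.\<close>
  have ne: "?s \<noteq> ?p" using i(1) vs(1) by (cases "Suc i = m") auto
  have "(v, z) \<in> parcs C \<longleftrightarrow> z = vs ! ?s \<or> z = vs ! ?p" for z
  proof
    assume "(v, z) \<in> parcs C"
    then obtain j where j: "j < m" "(vs ! i = vs ! j \<and> z = vs ! (Suc j mod m)) \<or>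
      (vs ! i = vs ! (Suc j mod m) \<and> z = vs ! j)" unfolding vs(5) i(2) by blast
    have lt': "Suc j mod m < m" using vs(1) by simp
    from j(2) show "z = vs ! ?s \<or> z = vs ! ?p"
    proof (elim disjE conjE)
      assume "vs ! i = vs ! j" and z: "z = vs ! (Suc j mod m)"
      then have "i = j" using inj[OF i(1) j(1)] by simp
      with z show ?thesis by simp
    next
      assume "vs ! i = vs ! (Suc j mod m)" and z: "z = vs ! j"
      then have "j = ?p" using inj[OF i(1) lt'] sj[OF j(1)] by simp
      with z show ?thesis by simp
    qed
  next
    have "(v, vs ! ?s) \<in> parcs C" unfolding vs(5) using i by blast
    moreover have "Suc ?p mod m = i" using sj[OF lt(2)] by simp
    then have "(v, vs ! ?p) \<in> (\<Union>i<m. {(vs ! i, vs ! (Suc i mod m)), (vs ! (Suc i mod m), vs ! i)})"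
      using i(2) lt(2) by (intro UN_I[of ?p]) simp_all
    then have "(v, vs ! ?p) \<in> parcs C" using vs(5) by simp
    ultimately show "(v, z) \<in> parcs C" if "z = vs ! ?s \<or> z = vs ! ?p" using that by blast
  qed
  then show "\<exists>u w. u \<noteq> w \<and> {z. (v, z) \<in> parcs C} = {u, w}"
    using inj[OF lt] ne by (intro exI[of _ "vs ! ?s"] exI[of _ "vs ! ?p"]) auto
qed

section \<open>Connected dominating sets of a unicycle graph\<close>

text \<open>Gives names to the cycle and its length; uniqueness is stated for cycles of every length
  \<open>k\<close>.\<close>

locale unicycle = pair_graph G for G :: "'a pair_pre_digraph" +
  fixes C :: "'a pair_pre_digraph" and m :: nat
  assumes connG: "conn G (pverts G)"
    and cycleC: "cycle_of m C G"
    and cycle_unique: "cycle_of k D G \<Longrightarrow> D = C"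

lemma unicycleI:
  assumes "unicycle_graph G" "cycle_of m C G"
  shows "unicycle G C m"
proof -
  from assms(1) interpret pair_graph G by (simp add: unicycle_graph_def)
  show ?thesis
  proof
    show "conn G (pverts G)" using assms(1) connected_iff by (simp add: unicycle_graph_def)
    show "cycle_of m C G" by fact
    show "D = C" if "cycle_of k D G" for k D
      using assms that unfolding unicycle_graph_def by blast
  qed
qed

context unicycle
begin

section \<open>Edges that are forced onto the unique cycle\<close>

lemma cycle_graph_C: "cycle_graph m C"
  using cycleC by (simp add: cycle_of_def)

lemma pverts_C_subset: "pverts C \<subseteq> pverts G" and parcs_C_subset: "parcs C \<subseteq> parcs G"
  using cycleC by (auto simp: cycle_of_def subgraph_def)

lemma finite_pverts_C: "finite (pverts C)"
  using pverts_C_subset pair_finite_verts by (rule finite_subset)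

lemma card_pverts_C: "card (pverts C) = m" "m \<ge> 3"
  using cycle_graph_props[OF cycle_graph_C] by simp_all

lemma parcs_C_in_pverts: "(u, v) \<in> parcs C \<Longrightarrow> u \<in> pverts C \<and> v \<in> pverts C"
  using cycle_graph_props(3)[OF cycle_graph_C] by blast

lemma parcs_C_sym: "(u, v) \<in> parcs C \<Longrightarrow> (v, u) \<in> parcs C"
proof -
  obtain vs where vs: "parcs C = (\<Union>i<m. {(vs ! i, vs ! (Suc i mod m)), (vs ! (Suc i mod m), vs ! i)})"
    using cycle_graph_C unfolding cycle_graph_def by blast
  show "(u, v) \<in> parcs C \<Longrightarrow> (v, u) \<in> parcs C" unfolding vs by blast
qed

lemma C_neighbours:
  assumes "v \<in> pverts C"
  obtains u w where "u \<noteq> w" "{z. (v, z) \<in> parcs C} = {u, w}"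
  using cycle_graph_props(4)[OF cycle_graph_C assms] by blast

text \<open>The walk from \<open>u\<close> to \<open>w\<close> shortens to a path in
  \<open>S\<close>, and \<open>v\<close> closes this path to a cycle, which must be
  \<open>C\<close>. All uses of the uniqueness of the cycle go through this lemma.\<close>

lemma cycle_through:
  assumes "S \<subseteq> pverts G" "v \<in> pverts G" "v \<notin> S" "(v, u) \<in> parcs G" "(v, w) \<in> parcs G" "u \<noteq> w"
    "(u, w) \<in> rtrancl_on S (parcs G)"
  shows "pverts C \<subseteq> insert v S" "(v, u) \<in> parcs C" "(v, w) \<in> parcs C"
proof -
  obtain p where p: "p \<noteq> []" "hd p = u" "last p = w" "distinct p" "set p \<subseteq> S"
    "successively (\<lambda>x y. (x, y) \<in> parcs G) p"
    using rtrancl_on_distinct_path[OF assms(7)] by blast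
  \<comment> \<open>The closed path is written as a graph \<open>D\<close> in exactly the shape that
    \<open>cycle_graph\<close> demands.\<close>
  define vs where "vs = v # p"
  define k where "k = length vs"
  define R where "R = (\<Union>i<k. {(vs ! i, vs ! (Suc i mod k)), (vs ! (Suc i mod k), vs ! i)})"
  define D where "D = \<lparr>pverts = set vs, parcs = R\<rparr>"
  \<comment> \<open>A path of length one would give \<open>u = w\<close>; hence the new cycle has at
    least three vertices.\<close>
  have "length p \<ge> 2"
  proof (rule ccontr)
    assume "\<not> length p \<ge> 2"
    moreover have "length p > 0" using p(1) by simp
    ultimately have "length p = 1" by linarith
    then obtain x where "p = [x]" by (auto simp: length_Suc_conv)
    with p assms(6) show False by simp
  qed
  then have k3: "k \<ge> 3" by (simp add: k_def vs_def)
  have dist: "distinct vs" using p assms(3) by (auto simp: vs_def)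
  have "successively (\<lambda>x y. (x, y) \<in> parcs G) vs"
    using p assms(4) by (simp add: vs_def successively_Cons)
  then have step: "(vs ! i, vs ! Suc i) \<in> parcs G" if "Suc i < k" for i
    using that by (simp add: k_def successively_conv_nth)
  have ends: "vs ! 0 = v" "vs ! 1 = u" "vs ! (k - 1) = w"
    using p by (simp_all add: vs_def k_def hd_conv_nth last_conv_nth nth_Cons')
  have arc: "(vs ! i, vs ! (Suc i mod k)) \<in> parcs G" if "i < k" for i
  proof (cases "Suc i = k")
    case True
    then have "vs ! i = w" "vs ! (Suc i mod k) = v" using ends by auto
    with arcs_symmetric[OF assms(5)] show ?thesis by simp
  next
    case False
    with that step show ?thesis by simp
  qed
  then have RG: "R \<subseteq> parcs G" unfolding R_def by (blast intro: arcs_symmetric)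
  have "vs ! i \<in> set vs" "vs ! (Suc i mod k) \<in> set vs" if "i < k" for i
    using that k3 unfolding k_def by (auto intro!: nth_mem mod_less_divisor)
  then have Rvs: "R \<subseteq> set vs \<times> set vs" unfolding R_def by blast
  have "cycle_graph k D"
    unfolding cycle_graph_def D_def R_def using k3 dist by (auto simp: k_def intro!: exI[of _ vs])
  moreover have "subgraph (with_proj D) (with_proj G)"
  proof (rule subgraphI)
    show "verts (with_proj D) \<subseteq> verts (with_proj G)"
      using p(5) assms(1,2) by (auto simp: D_def vs_def)
    show "wf_digraph (with_proj D)"
      using Rvs unfolding wf_digraph_wp_iff D_def by unfold_locales auto
    show "wf_digraph (with_proj G)" using wf_digraph_wp_iff pair_wf_digraph by blast
  qed (use RG in \<open>auto simp: D_def\<close>)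
  ultimately have D: "D = C" using cycle_unique[of k D] by (simp add: cycle_of_def)
  then have C: "pverts C = set vs" "parcs C = R" by (auto simp: D_def)
  show "pverts C \<subseteq> insert v S" using C(1) p(5) by (auto simp: vs_def)
  \<comment> \<open>Index 0 yields the edge from \<open>v\<close> to \<open>u\<close>; index
    \<open>k - 1\<close> wraps around and yields the edge from \<open>w\<close> back to
    \<open>v\<close>.\<close>
  have "Suc 0 < k" "Suc (k - 1) mod k = 0" using k3 by auto
  then show "(v, u) \<in> parcs C" "(v, w) \<in> parcs C"
    unfolding C R_def using ends k3 by (auto intro: bexI[of _ 0] bexI[of _ "k - 1"])
qed

text \<open>Without \<open>v\<close> the graph still joins \<open>u\<close> and \<open>w\<close>, so
  \<open>v\<close> closes a cycle with them.\<close>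

lemma noncut_neighbours:
  assumes "conn G (pverts G - {v})" "v \<in> pverts G" "(v, u) \<in> parcs G" "(v, w) \<in> parcs G" "u \<noteq> w"
  shows "(v, u) \<in> parcs C" "(v, w) \<in> parcs C"
proof -
  have "u \<in> pverts G - {v}" "w \<in> pverts G - {v}"
    using assms(3,4) in_arcsD2 no_loops' by blast+
  then have "(u, w) \<in> rtrancl_on (pverts G - {v}) (parcs G)" by (rule connD[OF assms(1)])
  then show "(v, u) \<in> parcs C" "(v, w) \<in> parcs C"
    using cycle_through[of "pverts G - {v}" v u w] assms(2-5) by auto
qed

text \<open>A neighbour \<open>u\<close> other than the cycle neighbour \<open>x\<close> is paired
  with \<open>x\<close> in \<open>noncut_neighbours\<close>. Thus no edge leaves the cycle at a
  non-cut vertex.\<close>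

lemma noncut_cycle_neighbour:
  assumes "conn G (pverts G - {v})" "v \<in> pverts C" "(v, u) \<in> parcs G"
  shows "(v, u) \<in> parcs C"
proof -
  obtain x y where xy: "x \<noteq> y" "{z. (v, z) \<in> parcs C} = {x, y}" using C_neighbours[OF assms(2)] .
  then have "(v, x) \<in> parcs C" "(v, y) \<in> parcs C" by auto
  then have xyG: "(v, x) \<in> parcs G" "(v, y) \<in> parcs G" using parcs_C_subset by auto
  show ?thesis
  proof (cases "u = x")
    case True
    then show ?thesis using \<open>(v, x) \<in> parcs C\<close> by simp
  next
    case False
    then show ?thesis
      using noncut_neighbours[OF assms(1) _ assms(3) xyG(1)] assms(2) pverts_C_subset by auto
  qed
qed

text \<open>The path from \<open>b\<close> to \<open>c\<close> closes up through \<open>a\<close>,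
  and \<open>C\<close> has no fewer than three vertices.\<close>

lemma triangle_eq_C:
  assumes "(a, b) \<in> parcs G" "(b, c) \<in> parcs G" "(a, c) \<in> parcs G"
  shows "pverts C = {a, b, c}"
proof -
  have ne: "a \<noteq> b" "b \<noteq> c" "a \<noteq> c" using assms no_loops' by blast+
  have "(b, c) \<in> rtrancl_on {b, c} (parcs G)"
    by (rule rtrancl_on_into_rtrancl_on[OF _ assms(2)]) auto
  moreover have "{b, c} \<subseteq> pverts G" "a \<in> pverts G" using assms in_arcsD1 in_arcsD2 by blast+
  ultimately have "pverts C \<subseteq> {a, b, c}"
    using cycle_through(1)[of "{b, c}" a b c] assms ne by auto
  moreover have "card {a, b, c} = 3" using ne by simp
  ultimately show ?thesis
    using card_pverts_C card_seteq[of "{a, b, c}" "pverts C"] by simp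
qed

section \<open>The connected dominating sets in terms of cut vertices and \<open>Y\<close>\<close>

definition small :: "'a set \<Rightarrow> bool" where
  "small R \<longleftrightarrow> card R \<le> 2 \<and> (\<forall>a\<in>R. \<forall>b\<in>R. a \<noteq> b \<longrightarrow> (a, b) \<in> parcs G)"

definition Y :: "'a set" where
  "Y = {v \<in> pverts C. conn G (pverts G - {v})}"

lemma Y_subset: "Y \<subseteq> pverts C" by (auto simp: Y_def)

lemma finite_Y: "finite Y" using Y_subset finite_pverts_C by (rule finite_subset)

lemma pverts_C_cut: "v \<in> pverts C \<Longrightarrow> v \<in> Y \<or> v \<in> cut_vertices"
  using pverts_C_subset by (auto simp: Y_def cut_vertices_def)

lemma Y_not_cut: "v \<in> Y \<Longrightarrow> v \<notin> cut_vertices"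
  by (auto simp: Y_def cut_vertices_def)

lemma small_subset: "small R \<Longrightarrow> T \<subseteq> R \<Longrightarrow> finite R \<Longrightarrow> small T"
  unfolding small_def using card_mono[of R T] by auto

text \<open>Otherwise deleting \<open>a\<close> and \<open>b\<close> leaves a connected graph, since
  it contains \<open>S\<close> and \<open>S\<close> dominates. Both cycle neighbours of
  \<open>b\<close> survive, and a path between them closes through \<open>b\<close> to a cycle
  avoiding \<open>a\<close>, although \<open>a\<close> lies on the only cycle.\<close>

lemma cds_cycle_adjacent:
  assumes cds: "connected_dominating_set G S"
    and a: "a \<in> pverts C - S" and b: "b \<in> pverts C - S" and ne: "a \<noteq> b"
  shows "(a, b) \<in> parcs G"
proof (rule ccontr)
  assume nadj: "(a, b) \<notin> parcs G"
  let ?T = "pverts G - {a, b}"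
  from cds have S: "conn G S" "S \<subseteq> pverts G"
    and dom: "\<And>v. v \<in> pverts G - S \<Longrightarrow> \<exists>u\<in>S. (u, v) \<in> parcs G"
    unfolding cds_iff by auto
  have T: "conn G ?T"
  proof (rule conn_superset[OF S(1)])
    show "S \<subseteq> ?T" using S(2) a b by blast
  qed (use dom in blast)
  obtain u w where uw: "u \<noteq> w" "{z. (b, z) \<in> parcs C} = {u, w}" using C_neighbours b by blast
  then have "(b, u) \<in> parcs C" "(b, w) \<in> parcs C" by auto
  then have adj: "(b, u) \<in> parcs G" "(b, w) \<in> parcs G" using parcs_C_subset by auto
  have "u \<noteq> a" "w \<noteq> a" using adj nadj arcs_symmetric by blast+
  then have "u \<in> ?T" "w \<in> ?T" using adj in_arcsD2 no_loops' by blast+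
  then have "(u, w) \<in> rtrancl_on ?T (parcs G)" by (rule connD[OF T])
  then have "pverts C \<subseteq> insert b ?T"
    using cycle_through(1)[of ?T b u w] adj uw(1) b pverts_C_subset by auto
  with a ne show False by blast
qed

lemma cds_cycle_noncut:
  assumes "connected_dominating_set G S" "v \<in> pverts C - S"
  shows "v \<in> Y"
  using cut_vertices_subset_cds[OF assms(1)] assms(2) pverts_C_cut by blast

text \<open>Three missing cycle vertices would form a triangle, hence all of \<open>C\<close>. They
  are non-cut, so their neighbours lie on \<open>C\<close> as well and none of them is dominated by
  \<open>S\<close>.\<close>

lemma cds_cycle_small:
  assumes cds: "connected_dominating_set G S"
  shows "small (pverts C - S)"
proof -
  have "card (pverts C - S) \<le> 2"
  proof (rule ccontr)
    assume "\<not> card (pverts C - S) \<le> 2"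
    then have "3 \<le> card (pverts C - S)" by simp
    then obtain B where "B \<subseteq> pverts C - S" "card B = 3" by (rule obtain_subset_with_card_n) auto
    then obtain a b c where abc: "{a, b, c} \<subseteq> pverts C - S" "a \<noteq> b" "b \<noteq> c" "a \<noteq> c"
      by (auto simp: card_3_iff)
    then have "(a, b) \<in> parcs G" "(b, c) \<in> parcs G" "(a, c) \<in> parcs G"
      using cds_cycle_adjacent[OF cds] by auto
    then have C: "pverts C = {a, b, c}" by (rule triangle_eq_C)
    have "a \<in> Y" using cds_cycle_noncut[OF cds] abc(1) by auto
    then have a: "a \<in> pverts C" "conn G (pverts G - {a})" by (auto simp: Y_def)
    moreover have "a \<in> pverts G - S" using a pverts_C_subset abc(1) by blast
    then obtain s where s: "s \<in> S" "(s, a) \<in> parcs G" using cds unfolding cds_iff by blast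
    ultimately have "(a, s) \<in> parcs C" using noncut_cycle_neighbour arcs_symmetric by blast
    then have "s \<in> {a, b, c}" using parcs_C_in_pverts C by blast
    with s(1) abc(1) show False by blast
  qed
  then show ?thesis unfolding small_def using cds_cycle_adjacent[OF cds] by blast
qed

text \<open>Converse of \<open>cut_vertices_subset_cds\<close> and \<open>cds_cycle_small\<close>.
  All vertices outside \<open>S\<close> are non-cut, so such a vertex with two neighbours lies in
  \<open>Y\<close> and both edges lie on \<open>C\<close>. Connectivity and domination are then
  checked separately.\<close>

lemma cdsI:
  assumes S: "S \<subseteq> pverts G" "S \<noteq> {}" and X: "cut_vertices \<subseteq> S" and small: "small (Y - S)"
  shows "connected_dominating_set G S"
proof -
  have noncut: "conn G (pverts G - {v})" if "v \<in> pverts G - S" for v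
    using that X unfolding cut_vertices_def by blast
  have inner: "v \<in> Y - S \<and> (v, u) \<in> parcs C \<and> (v, w) \<in> parcs C"
    if "v \<in> pverts G - S" "(v, u) \<in> parcs G" "(v, w) \<in> parcs G" "u \<noteq> w" for u v w
  proof -
    have "(v, u) \<in> parcs C" "(v, w) \<in> parcs C"
      using noncut_neighbours[OF noncut[OF that(1)] _ that(2-4)] that(1) by auto
    then show ?thesis using that(1) noncut parcs_C_in_pverts unfolding Y_def by blast
  qed
  have inner_path: "v \<in> Y - S \<and> (\<exists>u w. u \<noteq> w \<and> u \<in> set p \<and> w \<in> set p \<and> (v, u) \<in> parcs C \<and> (v, w) \<in> parcs C)"
    if "successively (\<lambda>x y. (x, y) \<in> parcs G) p" "distinct p" "set p \<subseteq> pverts G"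
      "v \<in> set p" "v \<notin> S" "hd p \<in> S" "last p \<in> S" for p v
  proof -
    have "sym (parcs G)" using sym_arcs by (simp add: symmetric_def)
    moreover have "v \<noteq> hd p" "v \<noteq> last p" using that by auto
    ultimately have "\<exists>u w. u \<in> set p \<and> w \<in> set p \<and> u \<noteq> w \<and> (v, u) \<in> parcs G \<and> (v, w) \<in> parcs G"
      using path_interior[OF that(1,2) _ that(4)] by blast
    then obtain u w where "u \<in> set p" "w \<in> set p" "u \<noteq> w" "(v, u) \<in> parcs G" "(v, w) \<in> parcs G"
      by blast
    moreover have "v \<in> pverts G - S" using that by blast
    ultimately show ?thesis using inner by blast
  qed
  have path_in: "(s, t) \<in> rtrancl_on S (parcs G)"
    if "successively (\<lambda>x y. (x, y) \<in> parcs G) p" "set p \<subseteq> S" "p \<noteq> []" "hd p = s" "last p = t" for p s t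
    using that
  proof (induct p arbitrary: s)
    case (Cons x p)
    show ?case
    proof (cases "p = []")
      case False
      then have "(hd p, t) \<in> rtrancl_on S (parcs G)" using Cons by (simp add: successively_Cons)
      moreover have "(s, hd p) \<in> parcs G" "s \<in> S" using Cons False by (auto simp: successively_Cons)
      ultimately show ?thesis by (metis converse_rtrancl_on_into_rtrancl_on)
    qed (use Cons in auto)
  qed simp
  have "(s, t) \<in> rtrancl_on S (parcs G)" if st: "s \<in> S" "t \<in> S" for s t
  proof (cases "Y - S = {}")
    case True
    have "(s, t) \<in> rtrancl_on (pverts G) (parcs G)" using connD[OF connG] st S by blast
    from rtrancl_on_distinct_path[OF this] obtain p where p: "p \<noteq> []" "hd p = s" "last p = t" "distinct p" "set p \<subseteq> pverts G"
      "successively (\<lambda>x y. (x, y) \<in> parcs G) p"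
      by blast
    have "set p \<subseteq> S" using inner_path[OF p(6,4,5)] p(2,3) st True by blast
    then show ?thesis using path_in p by blast
  next
    case False
    \<comment> \<open>The path from \<open>s\<close> to \<open>t\<close> is chosen to avoid a vertex
      \<open>r\<close> of \<open>Y - S\<close>. If it left \<open>S\<close> at \<open>v\<close>,
      smallness would make \<open>r\<close> a cycle neighbour of \<open>v\<close>; but both cycle
      neighbours of \<open>v\<close> are already on the path.\<close>
    then obtain r where r: "r \<in> Y" "r \<notin> S" by blast
    have "conn G (pverts G - {r})" using r by (simp add: Y_def)
    moreover have "s \<in> pverts G - {r}" "t \<in> pverts G - {r}" using st S r by blast+
    ultimately have "(s, t) \<in> rtrancl_on (pverts G - {r}) (parcs G)" by (rule connD)
    from rtrancl_on_distinct_path[OF this] obtain p where p: "p \<noteq> []" "hd p = s" "last p = t" "distinct p" "set p \<subseteq> pverts G - {r}"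
      "successively (\<lambda>x y. (x, y) \<in> parcs G) p"
      by blast
    have "set p \<subseteq> S"
    proof (rule subsetI, rule ccontr)
      fix v assume v: "v \<in> set p" "v \<notin> S"
      moreover have "set p \<subseteq> pverts G" using p(5) by blast
      ultimately obtain u w where uw: "v \<in> Y - S" "u \<noteq> w" "u \<in> set p" "w \<in> set p"
        "(v, u) \<in> parcs C" "(v, w) \<in> parcs C"
        using inner_path[OF p(6,4)] p(2,3) st by blast
      have "v \<noteq> r" using v p by blast
      with small r uw(1) have "(v, r) \<in> parcs G" unfolding small_def by blast
      then have "(v, r) \<in> parcs C" using noncut_cycle_neighbour uw(1) unfolding Y_def by blast
      moreover have "v \<in> pverts C" using uw(1) Y_def by blast
      then obtain x y where "{z. (v, z) \<in> parcs C} = {x, y}" using C_neighbours by metis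
      then have "\<And>z. (v, z) \<in> parcs C \<Longrightarrow> z = x \<or> z = y" by blast
      ultimately have "r = u \<or> r = w" using uw by metis
      then show False using uw p(5) by blast
    qed
    then show ?thesis using path_in p by blast
  qed
  then have conn: "conn G S" using S(2) unfolding conn_def by blast
  have "\<exists>u\<in>S. (u, v) \<in> parcs G" if v: "v \<in> pverts G - S" for v
  proof (rule ccontr)
    assume "\<not> (\<exists>u\<in>S. (u, v) \<in> parcs G)"
    then have no: "u \<notin> S" if "(v, u) \<in> parcs G" for u using that arcs_symmetric by blast
    \<comment> \<open>On a path from \<open>v\<close> to \<open>S\<close> the second vertex
      \<open>u\<close> is outside \<open>S\<close>, so the path goes on to some \<open>w\<close>.
      Having the two neighbours \<open>v\<close> and \<open>w\<close>, the non-cut vertex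
      \<open>u\<close> sends both edges along \<open>C\<close>.\<close>
    have vC: "v \<in> pverts C"
    proof -
      obtain s where s: "s \<in> S" using S by blast
      then have "(v, s) \<in> rtrancl_on (pverts G) (parcs G)" using connD[OF connG] v S by blast
      from rtrancl_on_distinct_path[OF this] obtain p where p: "p \<noteq> []" "hd p = v" "last p = s" "distinct p" "set p \<subseteq> pverts G"
        "successively (\<lambda>x y. (x, y) \<in> parcs G) p"
        by blast
      obtain u q where q: "p = v # u # q" using p(1-3) s v
        by (metis DiffE last_ConsL list.exhaust_sel)
      then have vu: "(v, u) \<in> parcs G" using p(6) by simp
      with no have u: "u \<notin> S" by blast
      then have "q \<noteq> []" using p(3) s q by auto
      then obtain w q' where "q = w # q'" by (cases q) auto
      with q p have "(u, w) \<in> parcs G" "v \<noteq> w" "u \<in> pverts G" by auto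
      then have "(u, v) \<in> parcs C" using inner[of u v w] arcs_symmetric[OF vu] u by blast
      then show ?thesis using parcs_C_in_pverts by blast
    qed
    then obtain x y where xy: "x \<noteq> y" "{z. (v, z) \<in> parcs C} = {x, y}" using C_neighbours by metis
    then have xyC: "(v, x) \<in> parcs C" "(v, y) \<in> parcs C" by auto
    then have xyG: "(v, x) \<in> parcs G" "(v, y) \<in> parcs G" using parcs_C_subset by auto
    then have "x \<notin> S" "y \<notin> S" "x \<noteq> v" "y \<noteq> v" using no no_loops' by auto
    \<comment> \<open>An undominated \<open>v\<close> and its two cycle neighbours are three
      vertices outside \<open>S\<close>, too many for a small set.\<close>
    then have "{v, x, y} \<subseteq> Y - S"
      using xyC vC v X pverts_C_cut parcs_C_in_pverts by blast
    moreover have "card {v, x, y} = 3" using xy(1) \<open>x \<noteq> v\<close> \<open>y \<noteq> v\<close> by auto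
    ultimately have "3 \<le> card (Y - S)" using card_mono[of "Y - S" "{v, x, y}"] finite_Y by simp
    then show False using small unfolding small_def by simp
  qed
  then show ?thesis using conn S unfolding cds_iff by blast
qed

end

section \<open>Coalition partitions\<close>

text \<open>The bound also makes the set of cardinalities finite, which gives \<open>Max\<close> its
  meaning.\<close>

lemma CC_eqI:
  assumes "connected_coalition_partition G \<Phi>" "card \<Phi> = k"
    and "\<And>\<Psi>. connected_coalition_partition G \<Psi> \<Longrightarrow> card \<Psi> \<le> k"
  shows "CC G = k"
proof -
  have "finite (card ` {\<Phi>. connected_coalition_partition G \<Phi>})"
    by (rule finite_subset[of _ "{..k}"]) (use assms(3) in auto)
  then have "Max (card ` {\<Phi>. connected_coalition_partition G \<Phi>}) = k"
    by (rule Max_eqI) (use assms in auto)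
  then show ?thesis using assms(1) by (auto simp: CC_def)
qed

lemma card_partition_on_le:
  assumes "partition_on A P" "finite A"
  shows "card P \<le> card A"
proof -
  have fin: "finite X" "X \<noteq> {}" if "X \<in> P" for X
    using that assms partition_onD1[OF assms(1)] partition_onD3[OF assms(1)]
    by (auto intro: finite_subset[of X A])
  have "card P = (\<Sum>X\<in>P. 1)" by simp
  also have "\<dots> \<le> (\<Sum>X\<in>P. card X)"
    using fin by (intro sum_mono) (simp add: Suc_le_eq card_gt_0_iff)
  also have "\<dots> = card (\<Union>P)"
    using fin partition_onD2[OF assms(1)]
    by (intro card_Union_disjoint[symmetric]) (auto simp: disjoint_def pairwise_def disjnt_def)
  finally show ?thesis using partition_onD1[OF assms(1)] by simp
qed

text \<open>A partner differs from \<open>A\<close> automatically, because partners are disjoint and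
  parts are nonempty.\<close>

lemma connected_coalition_partitionI:
  assumes part: "partition_on (pverts G) \<Phi>"
    and coal: "\<And>A. A \<in> \<Phi> \<Longrightarrow> \<exists>B\<in>\<Phi>. connected_coalition G A B"
  shows "connected_coalition_partition G \<Phi>"
proof -
  have "\<exists>B\<in>\<Phi> - {A}. connected_coalition G A B" if A: "A \<in> \<Phi>" for A
  proof -
    from coal[OF A] obtain B where B: "B \<in> \<Phi>" "connected_coalition G A B" by blast
    have "A \<noteq> {}" using A partition_onD3[OF part] by blast
    then have "B \<noteq> A" using B(2) unfolding connected_coalition_def by blast
    with B show ?thesis by blast
  qed
  with part show ?thesis unfolding connected_coalition_partition_def by blast
qed

lemma connected_coalition_commute: "connected_coalition G A B \<longleftrightarrow> connected_coalition G B A"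
  by (auto simp: connected_coalition_def Un_commute Int_commute)

context pair_graph
begin

text \<open>Extracts what the argument on the family uses: a full vertex \<open>c\<close>, a pendant
  vertex \<open>l\<close> from the star and a further vertex \<open>a\<close> from the
  triangle.\<close>

lemma triangle_star_pendant:
  assumes "triangle_star G"
  obtains c a l where "full_vertex G c" "{a, l} \<subseteq> pverts G - {c}" "a \<noteq> l"
    "\<And>u. (u, l) \<in> parcs G \<Longrightarrow> u = c"
proof -
  from assms obtain k T S c where k: "k \<ge> 1" and T: "complete_digraph 3 (with_proj T)"
    and S: "complete_bipartite_digraph 1 k (with_proj S)" and c: "full_vertex S c"
    and int: "pverts T \<inter> pverts S = {c}" and un: "with_proj G = union (with_proj T) (with_proj S)"
    unfolding triangle_star_def by blast
  have G: "pverts G = pverts T \<union> pverts S" "parcs G = parcs T \<union> parcs S"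
    using arg_cong[OF un, of verts] arg_cong[OF un, of arcs] by (simp_all add: union_def)
  from T have Tp: "card (pverts T) = 3"
    "parcs T = {(u, v). (u, v) \<in> pverts T \<times> pverts T \<and> u \<noteq> v}"
    unfolding complete_digraph_pair_def by auto
  from S obtain U W where finS: "finite (pverts S)" and UW: "pverts S = U \<union> W" "U \<inter> W = {}" "card U = 1"
    "card W = k" "parcs S = U \<times> W \<union> W \<times> U"
    unfolding complete_bipartite_digraph_pair_def by auto
  obtain x where x: "U = {x}" using UW(3) by (auto simp: card_1_singleton_iff)
  interpret S: pair_graph S using S by (rule pair_graphI_complete_bipartite)
  have cS: "c \<in> pverts S" "\<And>u. u \<in> pverts S \<Longrightarrow> u \<noteq> c \<Longrightarrow> (c, u) \<in> parcs S"
    using c unfolding S.full_vertex_iff by auto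
  \<comment> \<open>A full vertex of the star may lie on the side \<open>W\<close> only when
    \<open>W = {c}\<close>, that is, for a single edge; in both cases \<open>c\<close> is an end of
    every arc.\<close>
  have arcS: "u = c \<or> v = c" if "(u, v) \<in> parcs S" for u v
  proof (cases "c = x")
    case True
    then show ?thesis using that UW(5) x by auto
  next
    case False
    then have "c \<in> W" using cS(1) UW(1) x by auto
    moreover have "W \<subseteq> {c}"
    proof
      fix w assume "w \<in> W"
      then show "w \<in> {c}" using cS(2)[of w] UW(1,2,5) \<open>c \<in> W\<close> x by auto
    qed
    ultimately show ?thesis using that UW(5) x by auto
  qed
  have "card (pverts S) = 1 + k" using UW finS by (simp add: card_Un_disjoint)
  then have "card (pverts S - {c}) = k" using cS(1) finS by simp
  with k have "pverts S - {c} \<noteq> {}" by (metis card.empty not_one_le_zero)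
  then obtain l where l: "l \<in> pverts S" "l \<noteq> c" by blast
  have "c \<in> pverts T" using int by blast
  then have "card (pverts T - {c}) = 2" using Tp(1) by (simp add: card_Diff_singleton)
  then have "pverts T - {c} \<noteq> {}" by (metis card.empty zero_neq_numeral)
  then obtain a where a: "a \<in> pverts T" "a \<noteq> c" by blast
  show thesis
  proof
    show "full_vertex G c"
      unfolding full_vertex_iff using cS \<open>c \<in> pverts T\<close> Tp(2) G by auto
    show "{a, l} \<subseteq> pverts G - {c}" using a l G by auto
    show "a \<noteq> l" using a l int by blast
    fix u assume "(u, l) \<in> parcs G"
    moreover have "(u, l) \<notin> parcs T" using Tp(2) int l by blast
    ultimately have "(u, l) \<in> parcs S" using G by blast
    then show "u = c" using arcS l by blast
  qed
qed

text \<open>Every connected dominating set contains \<open>c\<close>, and every vertex set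
  containing \<open>c\<close> is one. So one of two candidate partners is always dominating and
  connected by itself, and no coalition exists. The part of \<open>l\<close> would then have to
  consist of a full vertex.\<close>

lemma triangle_star_no_partition:
  assumes "triangle_star G"
  shows "\<not> connected_coalition_partition G \<Phi>"
proof
  assume part: "connected_coalition_partition G \<Phi>"
  obtain c a l where c: "full_vertex G c" and al: "{a, l} \<subseteq> pverts G - {c}" "a \<noteq> l"
    and leaf: "\<And>u. (u, l) \<in> parcs G \<Longrightarrow> u = c"
    using triangle_star_pendant[OF assms] by blast
  have cdsc: "connected_dominating_set G {c}" using c by (simp add: full_vertex_iff_cds)
  have c_in: "c \<in> S" if cds: "connected_dominating_set G S" for S
  proof (rule ccontr)
    assume c: "c \<notin> S"
    with cds al leaf have l: "l \<in> S" unfolding cds_iff by blast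
    \<comment> \<open>Without \<open>c\<close> the pendant vertex has no way to reach any other
      vertex of \<open>S\<close>; but \<open>l\<close> alone does not dominate
      \<open>a\<close>.\<close>
    have "S \<subseteq> {l}"
    proof (rule subsetI, rule ccontr)
      fix s assume s: "s \<in> S" "s \<notin> {l}"
      have "conn G S" using cds unfolding cds_iff by blast
      then have "(l, s) \<in> rtrancl_on S (parcs G)" using l s(1) by (rule connD)
      from rtrancl_on_exit[OF this, of "{l}"] s(2) obtain y where "y \<in> S" "(l, y) \<in> parcs G"
        by blast
      then have "y \<in> S" "(y, l) \<in> parcs G" using arcs_symmetric by auto
      with leaf c show False by blast
    qed
    then have "(l, a) \<in> parcs G" using cds al unfolding cds_iff by blast
    then have "a = c" using leaf arcs_symmetric by blast
    with al show False by blast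
  qed
  have not_coal: "\<not> connected_coalition G A B" for A B
  proof
    assume AB: "connected_coalition G A B"
    then have "c \<in> A \<union> B" using c_in unfolding connected_coalition_def by blast
    then have "connected_dominating_set G A \<or> connected_dominating_set G B"
      using AB cds_superset[OF cdsc] unfolding connected_coalition_def by blast
    with AB show False unfolding connected_coalition_def by blast
  qed
  have "l \<in> \<Union>\<Phi>" using part al unfolding connected_coalition_partition_def partition_on_def by blast
  then obtain A where A: "A \<in> \<Phi>" "l \<in> A" by blast
  then obtain v where "full_vertex G v" "A = {v}"
    using part not_coal unfolding connected_coalition_partition_def by blast
  then have "connected_dominating_set G {l}" using A(2) by (simp add: full_vertex_iff_cds)
  then have "c \<in> {l}" by (rule c_in)
  with al show False by blast
qed

section \<open>Partners and hubs in a coalition partition\<close>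

lemma coalition_partition_partner:
  assumes "connected_coalition_partition G \<Phi>" "\<And>v. \<not> full_vertex G v" "A \<in> \<Phi>"
  obtains B where "B \<in> \<Phi>" "B \<noteq> A" "connected_coalition G A B"
  using assms unfolding connected_coalition_partition_def by blast

lemma coalition_partition_disjoint:
  assumes "connected_coalition_partition G \<Phi>" "A \<in> \<Phi>" "B \<in> \<Phi>" "A \<noteq> B"
  shows "A \<inter> B = {}"
  using assms unfolding connected_coalition_partition_def partition_on_def disjoint_def by blast

lemma coalition_partition_nonempty:
  assumes "connected_coalition_partition G \<Phi>" "A \<in> \<Phi>"
  shows "A \<noteq> {}" "A \<subseteq> pverts G"
  using assms unfolding connected_coalition_partition_def partition_on_def by blast+

lemma coalition_cut_vertices:
  assumes "connected_coalition G A B"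
  shows "cut_vertices \<subseteq> A \<union> B"
  using assms cut_vertices_subset_cds unfolding connected_coalition_def by blast

text \<open>All cut vertices lie in \<open>A0 \<union> B0\<close> and also in the coalition of a
  third part \<open>D\<close> with \<open>E\<close>. As \<open>D\<close> is disjoint from the
  former, they all lie in \<open>E\<close>. Every coalition must contain them, so every other part
  needs \<open>E\<close> as its partner.\<close>

lemma coalition_partition_hub:
  assumes part: "connected_coalition_partition G \<Phi>" and nf: "\<And>v. \<not> full_vertex G v"
    and X: "cut_vertices \<noteq> {}" and card: "card \<Phi> \<ge> 3"
  obtains A where "A \<in> \<Phi>" "cut_vertices \<subseteq> A" "\<And>B. B \<in> \<Phi> \<Longrightarrow> B \<noteq> A \<Longrightarrow> connected_coalition G A B"
proof -
  obtain A0 where A0: "A0 \<in> \<Phi>" using card by fastforce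
  obtain B0 where B0: "B0 \<in> \<Phi>" "B0 \<noteq> A0" "connected_coalition G A0 B0"
    using coalition_partition_partner[OF part nf A0] .
  have "\<not> \<Phi> \<subseteq> {A0, B0}"
  proof
    assume "\<Phi> \<subseteq> {A0, B0}"
    then have "card \<Phi> \<le> card {A0, B0}" by (intro card_mono) auto
    also have "\<dots> \<le> 2" by (simp add: card_insert_if)
    finally show False using card by simp
  qed
  then obtain D where D: "D \<in> \<Phi>" "D \<noteq> A0" "D \<noteq> B0" by blast
  obtain E where E: "E \<in> \<Phi>" "E \<noteq> D" "connected_coalition G D E"
    using coalition_partition_partner[OF part nf D(1)] .
  note disj = coalition_partition_disjoint[OF part]
  have sub: "cut_vertices \<subseteq> A0 \<union> B0" "cut_vertices \<subseteq> D \<union> E"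
    using B0(3) E(3) by (simp_all add: coalition_cut_vertices)
  have "D \<inter> A0 = {}" "D \<inter> B0 = {}" using disj A0 B0(1) D by blast+
  then have "cut_vertices \<subseteq> E" using sub by blast
  moreover have "connected_coalition G E B" if B: "B \<in> \<Phi>" "B \<noteq> E" for B
  proof -
    obtain F where F: "F \<in> \<Phi>" "F \<noteq> B" "connected_coalition G B F"
      using coalition_partition_partner[OF part nf B(1)] .
    have "cut_vertices \<subseteq> B \<union> F" using F(3) by (rule coalition_cut_vertices)
    moreover have "B \<inter> E = {}" using disj B E(1) by blast
    ultimately have "F \<inter> E \<noteq> {}" using \<open>cut_vertices \<subseteq> E\<close> X by blast
    then have "F = E" using disj F(1) E(1) by blast
    then show ?thesis using F(3) connected_coalition_commute by blast
  qed
  ultimately show thesis using that E(1) by blast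
qed

text \<open>In the partition into singletons, the ends of two opposite edges form the coalitions; a
  single vertex fails to dominate the vertex opposite to it.\<close>

lemma CC_4_cycle:
  assumes "cycle_graph 4 G"
  shows "CC G = 4"
proof -
  obtain vs where vs: "distinct vs" "length vs = 4" "pverts G = set vs"
    "parcs G = (\<Union>i<4. {(vs ! i, vs ! (Suc i mod 4)), (vs ! (Suc i mod 4), vs ! i)})"
    using assms unfolding cycle_graph_def by blast
  obtain a b c d where abcd: "vs = [a, b, c, d]"
    using vs(2) by (auto simp: numeral_eq_Suc length_Suc_conv)
  have dist: "distinct [a, b, c, d]" using vs(1) abcd by simp
  have V: "pverts G = {a, b, c, d}" using vs(3) abcd by simp
  have "{..<4::nat} = {0, 1, 2, 3}" by auto
  then have E: "parcs G = {(a, b), (b, a), (b, c), (c, b), (c, d), (d, c), (d, a), (a, d)}"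
    unfolding vs(4) abcd by auto
  have pair: "connected_dominating_set G {x, y}"
    if "(x, y) \<in> parcs G" "\<forall>v\<in>pverts G - {x, y}. (x, v) \<in> parcs G \<or> (y, v) \<in> parcs G"
      "x \<in> pverts G" "y \<in> pverts G" for x y
  proof -
    have "conn G {x, y}" by (rule conn_star[of y]) (use that(1) in auto)
    then show ?thesis unfolding cds_iff using that by blast
  qed
  have cds: "connected_dominating_set G {a, b}" "connected_dominating_set G {c, d}"
    by (rule pair; use dist in \<open>auto simp: V E\<close>)+
  have single: "\<not> connected_dominating_set G {x}"
    if "y \<in> pverts G" "y \<noteq> x" "(x, y) \<notin> parcs G" for x y
    using that unfolding cds_iff by blast
  have ns: "\<not> connected_dominating_set G {a}" "\<not> connected_dominating_set G {b}"
    "\<not> connected_dominating_set G {c}" "\<not> connected_dominating_set G {d}"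
    by (rule single[of c] single[of d] single[of a] single[of b]; use dist in \<open>auto simp: V E\<close>)+
  have coal: "connected_coalition G {a} {b}" "connected_coalition G {c} {d}"
    unfolding connected_coalition_def using cds ns dist V by (auto simp: insert_commute)
  let ?P = "(\<lambda>v. {v}) ` pverts G"
  show ?thesis
  proof (rule CC_eqI[of G ?P])
    have "partition_on (pverts G) ?P" by (auto simp: partition_on_def disjoint_def)
    then show "connected_coalition_partition G ?P"
    proof (rule connected_coalition_partitionI)
      fix A assume "A \<in> ?P"
      then show "\<exists>B\<in>?P. connected_coalition G A B"
        unfolding V using coal coal[THEN connected_coalition_commute[THEN iffD1]] by auto
    qed
    show card: "card ?P = 4" using dist by (simp add: card_image V)
    fix \<Psi> assume "connected_coalition_partition G \<Psi>"
    then have "partition_on (pverts G) \<Psi>" unfolding connected_coalition_partition_def by blast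
    then have "card \<Psi> \<le> card (pverts G)" using pair_finite_verts by (rule card_partition_on_le)
    then show "card \<Psi> \<le> 4" using dist by (simp add: V)
  qed
qed

end

section \<open>The connected coalition number of a unicycle graph\<close>

context unicycle
begin

text \<open>If no cycle vertex is a cut vertex, then no edge leaves the cycle, and connectivity
  leaves nothing outside it.\<close>

lemma Y_eq_C_imp:
  assumes "Y = pverts C"
  shows "pverts G = pverts C" "G = C" "cut_vertices = {}"
proof -
  have nb: "(x, y) \<in> parcs C" if "x \<in> pverts C" "(x, y) \<in> parcs G" for x y
    using noncut_cycle_neighbour[of x y] that assms unfolding Y_def by blast
  have "pverts G \<subseteq> pverts C"
  proof (rule subsetI, rule ccontr)
    fix v assume v: "v \<in> pverts G" "v \<notin> pverts C"
    have "pverts C \<noteq> {}" using card_pverts_C by auto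
    then obtain u where u: "u \<in> pverts C" by blast
    then have "u \<in> pverts G" using pverts_C_subset by blast
    then have "(u, v) \<in> rtrancl_on (pverts G) (parcs G)" using v(1) by (rule connD[OF connG])
    from rtrancl_on_exit[OF this u v(2)] obtain x y
      where "x \<in> pverts C" "y \<notin> pverts C" "(x, y) \<in> parcs G" by blast
    with nb parcs_C_in_pverts show False by blast
  qed
  with pverts_C_subset show V: "pverts G = pverts C" by blast
  have "parcs G \<subseteq> parcs C" using nb in_arcsD1 V by auto
  with parcs_C_subset have "parcs G = parcs C" by blast
  with V show "G = C" by simp
  have "cut_vertices \<subseteq> pverts C" unfolding cut_vertices_def using V by blast
  then show "cut_vertices = {}" using assms Y_not_cut by blast
qed

text \<open>If \<open>Y\<close> is pairwise adjacent, failing to be small means having three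
  vertices. They form a triangle, which is \<open>C\<close>, so all of \<open>C\<close> is non-cut
  and \<open>G\<close> is this triangle.\<close>

lemma not_small_Y_cases:
  assumes "\<not> small Y"
  obtains (nonadjacent) a b where "a \<in> Y" "b \<in> Y" "a \<noteq> b" "(a, b) \<notin> parcs G"
  | (triangle) "card (pverts G) = 3"
proof (cases "\<forall>a\<in>Y. \<forall>b\<in>Y. a \<noteq> b \<longrightarrow> (a, b) \<in> parcs G")
  case True
  then have "3 \<le> card Y" using assms unfolding small_def by auto
  then obtain B where "B \<subseteq> Y" "card B = 3" by (rule obtain_subset_with_card_n) auto
  then obtain a b c where abc: "{a, b, c} \<subseteq> Y" "a \<noteq> b" "b \<noteq> c" "a \<noteq> c"
    by (auto simp: card_3_iff)
  then have "(a, b) \<in> parcs G" "(b, c) \<in> parcs G" "(a, c) \<in> parcs G" using True by auto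
  then have C: "pverts C = {a, b, c}" by (rule triangle_eq_C)
  then have "Y = pverts C" using Y_subset abc(1) by blast
  then have "card (pverts G) = 3" using Y_eq_C_imp(1) C abc by simp
  then show thesis by (rule triangle)
next
  case False
  then show thesis using nonadjacent by blast
qed

text \<open>A full vertex differs from the nonadjacent \<open>a\<close> and \<open>b\<close>, so it
  would be a connected dominating set missing two nonadjacent cycle vertices.\<close>

lemma no_full_vertex:
  assumes "\<not> small Y" "card (pverts G) \<noteq> 3"
  shows "\<not> full_vertex G v"
proof
  assume v: "full_vertex G v"
  obtain a b where ab: "a \<in> Y" "b \<in> Y" "a \<noteq> b" "(a, b) \<notin> parcs G"
    using not_small_Y_cases[OF assms(1)] assms(2) by metis
  have "a \<in> pverts G" "b \<in> pverts G" using ab Y_subset pverts_C_subset by blast+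
  then have va: "v \<noteq> a" "v \<noteq> b" using v ab arcs_symmetric unfolding full_vertex_iff by blast+
  have cds: "connected_dominating_set G {v}" using v by (simp add: full_vertex_iff_cds)
  have "a \<in> pverts C - {v}" "b \<in> pverts C - {v}" using ab va Y_subset by blast+
  then show False using cds_cycle_adjacent[OF cds] ab by blast
qed

text \<open>Replaces \<open>coalition_partition_hub\<close> when there are no cut vertices. A
  coalition misses at most two vertices, so with four parts the parts outside it are singletons. It
  has at least three vertices, so one of its parts \<open>A\<close> is not a singleton and hence
  cannot lie outside any coalition.\<close>

lemma cycle_partition_hub:
  assumes part: "connected_coalition_partition G \<Phi>" and nf: "\<And>v. \<not> full_vertex G v"
    and V: "pverts G = pverts C" "m \<ge> 5" and card: "card \<Phi> \<ge> 4"
  obtains A where "A \<in> \<Phi>" "\<And>B. B \<in> \<Phi> \<Longrightarrow> B \<noteq> A \<Longrightarrow> connected_coalition G A B"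
proof -
  note disj = coalition_partition_disjoint[OF part]
  note ne = coalition_partition_nonempty[OF part]
  have finV: "finite (pverts G)" by (rule pair_finite_verts)
  have big: "3 \<le> card (A \<union> B)" "card (pverts G - (A \<union> B)) \<le> 2"
    if "connected_coalition G A B" for A B
  proof -
    have cds: "connected_dominating_set G (A \<union> B)" using that unfolding connected_coalition_def by blast
    then have "small (pverts C - (A \<union> B))" by (rule cds_cycle_small)
    then show le2: "card (pverts G - (A \<union> B)) \<le> 2" using V unfolding small_def by simp
    have "A \<union> B \<subseteq> pverts G" using cds unfolding cds_iff by blast
    then have "card (pverts G - (A \<union> B)) = card (pverts G) - card (A \<union> B)"
      using finV by (intro card_Diff_subset) (auto intro: finite_subset)
    moreover have "card (pverts G) \<ge> 5" using V card_pverts_C by simp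
    ultimately show "3 \<le> card (A \<union> B)" using le2 by simp
  qed
  have single: "card D = 1"
    if "A \<in> \<Phi>" "B \<in> \<Phi>" "connected_coalition G A B" "D \<in> \<Phi>" "D \<noteq> A" "D \<noteq> B" for A B D
  proof -
    have "\<not> \<Phi> \<subseteq> {A, B, D}"
    proof
      assume "\<Phi> \<subseteq> {A, B, D}"
      then have "card \<Phi> \<le> card {A, B, D}" by (intro card_mono) auto
      also have "\<dots> \<le> 3" by (simp add: card_insert_if)
      finally show False using card by simp
    qed
    then obtain E where E: "E \<in> \<Phi>" "E \<noteq> A" "E \<noteq> B" "E \<noteq> D" by blast
    have fin: "finite D" "finite E" using finite_subset[OF ne(2) finV] that(4) E(1) by blast+
    have "D \<union> E \<subseteq> pverts G - (A \<union> B)" using disj ne that E by blast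
    then have "card (D \<union> E) \<le> 2"
      using card_mono[of "pverts G - (A \<union> B)" "D \<union> E"] finV big(2)[OF that(3)] by simp
    moreover have "D \<inter> E = {}" using disj that(4) E by blast
    then have "card (D \<union> E) = card D + card E" using fin by (simp add: card_Un_disjoint)
    moreover have "card D > 0" "card E > 0" using ne(1) that(4) E(1) fin by (auto simp: card_gt_0_iff)
    ultimately show ?thesis by simp
  qed
  have two: "card A \<noteq> 1 \<or> card B \<noteq> 1" if "connected_coalition G A B" for A B
    using big(1)[OF that] card_Un_le[of A B] by linarith
  obtain A0 where A0: "A0 \<in> \<Phi>" using card by fastforce
  obtain B0 where B0: "B0 \<in> \<Phi>" "B0 \<noteq> A0" "connected_coalition G A0 B0"
    using coalition_partition_partner[OF part nf A0] .
  then have "\<exists>A B. A \<in> \<Phi> \<and> B \<in> \<Phi> \<and> connected_coalition G A B \<and> card A \<noteq> 1"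
    using two[OF B0(3)] A0 connected_coalition_commute by blast
  then obtain A B where AB: "A \<in> \<Phi>" "B \<in> \<Phi>" "connected_coalition G A B" "card A \<noteq> 1" by blast
  have "connected_coalition G A E" if E: "E \<in> \<Phi>" "E \<noteq> A" for E
  proof (cases "E = B")
    case False
    obtain F where F: "F \<in> \<Phi>" "F \<noteq> E" "connected_coalition G E F"
      using coalition_partition_partner[OF part nf E(1)] .
    have "F = A"
      using single[OF E(1) F(1,3) AB(1)] AB(4) E(2) by blast
    then show ?thesis using F(3) connected_coalition_commute by blast
  qed (use AB in simp)
  then show thesis using that AB(1) by blast
qed

text \<open>Three parts besides the hub each contain a vertex of \<open>Y\<close>. The coalition of
  the hub with one of them misses the chosen vertices of the other two, which are therefore
  adjacent; the resulting triangle is all of \<open>G\<close>.\<close>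

lemma card_hub_partition_le:
  assumes part: "connected_coalition_partition G \<Phi>" and A: "A \<in> \<Phi>" "cut_vertices \<subseteq> A"
    and hub: "\<And>B. B \<in> \<Phi> \<Longrightarrow> B \<noteq> A \<Longrightarrow> connected_coalition G A B"
    and card: "card (pverts G) \<noteq> 3"
  shows "card \<Phi> \<le> 3"
proof (rule ccontr)
  assume "\<not> card \<Phi> \<le> 3"
  then have "3 \<le> card (\<Phi> - {A})" using A(1) by (simp add: card_Diff_singleton)
  then obtain B where "B \<subseteq> \<Phi> - {A}" "card B = 3" by (rule obtain_subset_with_card_n) auto
  then obtain B1 B2 B3 where B: "B1 \<in> \<Phi>" "B2 \<in> \<Phi>" "B3 \<in> \<Phi>" "B1 \<noteq> A" "B2 \<noteq> A" "B3 \<noteq> A"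
    "B1 \<noteq> B2" "B2 \<noteq> B3" "B1 \<noteq> B3"
    by (auto simp: card_3_iff)
  note disj = coalition_partition_disjoint[OF part]
  note ne = coalition_partition_nonempty[OF part]
  have cds: "connected_dominating_set G (A \<union> B)" "\<not> connected_dominating_set G A"
    if "B \<in> \<Phi>" "B \<noteq> A" for B
    using hub[OF that] unfolding connected_coalition_def by blast+
  have meets: "\<exists>e. e \<in> B \<and> e \<in> Y" if "B \<in> \<Phi>" "B \<noteq> A" for B
  proof (rule ccontr)
    assume "\<not> (\<exists>e. e \<in> B \<and> e \<in> Y)"
    \<comment> \<open>If \<open>B\<close> contributes nothing to \<open>Y\<close>, then what
      \<open>A\<close> misses of \<open>Y\<close> is already small, and the hub alone would be a
      connected dominating set.\<close>
    then have "Y - A \<subseteq> pverts C - (A \<union> B)" using Y_subset by blast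
    then have "small (Y - A)"
      using small_subset[OF cds_cycle_small[OF cds(1)[OF that]]] finite_pverts_C by blast
    then have "connected_dominating_set G A" using ne[OF A(1)] A(2) by (intro cdsI)
    with cds(2)[OF that] show False by blast
  qed
  obtain e1 where e1: "e1 \<in> B1" "e1 \<in> Y" using meets B(1,4) by blast
  obtain e2 where e2: "e2 \<in> B2" "e2 \<in> Y" using meets B(2,5) by blast
  obtain e3 where e3: "e3 \<in> B3" "e3 \<in> Y" using meets B(3,6) by blast
  have adj: "(e, e') \<in> parcs G"
    if "D \<in> \<Phi>" "D \<noteq> A" "E \<in> \<Phi>" "E' \<in> \<Phi>" "E \<noteq> A" "E' \<noteq> A" "E \<noteq> D" "E' \<noteq> D" "E \<noteq> E'"
      "e \<in> E" "e' \<in> E'" "e \<in> Y" "e' \<in> Y" for D E E' e e'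
  proof -
    have "e \<notin> A" "e' \<notin> A" "e \<notin> D" "e' \<notin> D" "e' \<notin> E"
      using disj[OF that(3) A(1) that(5)] disj[OF that(4) A(1) that(6)] disj[OF that(3,1,7)]
        disj[OF that(4,1,8)] disj[OF that(3,4,9)] that(10,11) by auto
    then have "e \<in> pverts C - (A \<union> D)" "e' \<in> pverts C - (A \<union> D)" "e \<noteq> e'"
      using that(10,12,13) Y_subset by auto
    then show ?thesis by (rule cds_cycle_adjacent[OF cds(1)[OF that(1,2)]])
  qed
  have "(e1, e2) \<in> parcs G" "(e2, e3) \<in> parcs G" "(e1, e3) \<in> parcs G"
    using adj[of B3 B1 B2 e1 e2] adj[of B1 B2 B3 e2 e3] adj[of B2 B1 B3 e1 e3] B e1 e2 e3 by auto
  moreover from this have "e1 \<noteq> e2" "e2 \<noteq> e3" "e1 \<noteq> e3" using no_loops' by blast+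
  ultimately have C: "pverts C = {e1, e2, e3}" "card (pverts C) = 3" using triangle_eq_C by auto
  have "pverts C \<subseteq> Y" using e1(2) e2(2) e3(2) unfolding C(1) by simp
  then have "Y = pverts C" using Y_subset by simp
  then show False using Y_eq_C_imp(1) C(2) card by simp
qed

lemma card_partition_le_3:
  assumes part: "connected_coalition_partition G \<Phi>"
    and "\<not> small Y" "card (pverts G) \<noteq> 3" "\<not> cycle_graph 4 G"
  shows "card \<Phi> \<le> 3"
proof (rule ccontr)
  assume c: "\<not> card \<Phi> \<le> 3"
  note nf = no_full_vertex[OF assms(2,3)]
  show False
  proof (cases "cut_vertices = {}")
    case True
    then have "Y = pverts C" using Y_subset pverts_C_cut by blast
    then have GC: "pverts G = pverts C" "G = C" by (rule Y_eq_C_imp)+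
    \<comment> \<open>Since \<open>G = C\<close>, the excluded graphs are exactly the cycles of
      length three and four.\<close>
    then have "m \<noteq> 3" "m \<noteq> 4" using assms(3,4) card_pverts_C cycle_graph_C by auto
    then have "m \<ge> 5" using card_pverts_C by simp
    moreover have "card \<Phi> \<ge> 4" using c by simp
    ultimately obtain A where "A \<in> \<Phi>" "\<And>B. B \<in> \<Phi> \<Longrightarrow> B \<noteq> A \<Longrightarrow> connected_coalition G A B"
      using cycle_partition_hub[OF part nf GC(1)] by blast
    then show False using card_hub_partition_le[OF part _ _ _ assms(3)] c True by blast
  next
    case False
    have "card \<Phi> \<ge> 3" using c by simp
    then obtain A where "A \<in> \<Phi>" "cut_vertices \<subseteq> A" "\<And>B. B \<in> \<Phi> \<Longrightarrow> B \<noteq> A \<Longrightarrow> connected_coalition G A B"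
      using coalition_partition_hub[OF part nf False] by blast
    then show False using card_hub_partition_le[OF part _ _ _ assms(3)] c by blast
  qed
qed

section \<open>The values two and three\<close>

lemma cds_pverts: "connected_dominating_set G (pverts G)"
  unfolding cds_iff using connG by blast

lemma cds_del_Y:
  assumes "v \<in> Y"
  shows "connected_dominating_set G (pverts G - {v})"
proof -
  have v: "v \<in> pverts C" "conn G (pverts G - {v})" using assms by (auto simp: Y_def)
  obtain u w where "{z. (v, z) \<in> parcs C} = {u, w}" using C_neighbours[OF v(1)] by metis
  then have "(v, u) \<in> parcs C" by blast
  then have "(v, u) \<in> parcs G" using parcs_C_subset by blast
  then have "(u, v) \<in> parcs G" "u \<in> pverts G - {v}"
    using arcs_symmetric in_arcsD2 no_loops' by blast+
  then show ?thesis unfolding cds_iff using v(2) by blast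
qed

text \<open>Separating two cut vertices makes both parts fail, while their union is everything. With
  three parts, the hub contains all cut vertices; as \<open>Y\<close> is small, \<open>cdsI\<close>
  makes the hub a connected dominating set, which a coalition forbids.\<close>

lemma CC_eq_2:
  assumes small: "small Y" and X: "card cut_vertices \<ge> 2"
  shows "CC G = 2"
proof -
  have X2: "\<not> cut_vertices \<subseteq> {v}" for v
    using X card_mono[of "{v}" cut_vertices] by auto
  then have Xne: "cut_vertices \<noteq> {}" by auto
  have nf: "\<not> full_vertex G v" for v
    using X2 cut_vertices_subset_cds unfolding full_vertex_iff_cds by blast
  obtain x where x: "x \<in> cut_vertices" using Xne by blast
  have xV: "x \<in> pverts G" using x unfolding cut_vertices_def by blast
  obtain y where y: "y \<in> cut_vertices" "y \<noteq> x" using X2 by blast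
  have yV: "y \<in> pverts G" using y unfolding cut_vertices_def by blast
  let ?A = "{x}" and ?B = "pverts G - {x}"
  have un: "?A \<union> ?B = pverts G" using xV by blast
  have "\<not> connected_dominating_set G ?A" "\<not> connected_dominating_set G ?B"
    using cut_vertices_subset_cds X2 x by blast+
  then have coal: "connected_coalition G ?A ?B"
    unfolding connected_coalition_def un using cds_pverts xV by auto
  show ?thesis
  proof (rule CC_eqI[of G "{?A, ?B}"])
    have "partition_on (pverts G) {?A, ?B}"
      using xV yV y(2) by (auto simp: partition_on_def disjoint_def)
    then show "connected_coalition_partition G {?A, ?B}"
      by (rule connected_coalition_partitionI)
        (use coal connected_coalition_commute[of G ?A ?B] in \<open>elim insertE emptyE; simp\<close>)
    have "?A \<noteq> ?B" by blast
    then show "card {?A, ?B} = 2" by simp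
    fix \<Psi> assume part: "connected_coalition_partition G \<Psi>"
    show "card \<Psi> \<le> 2"
    proof (rule ccontr)
      assume "\<not> card \<Psi> \<le> 2"
      then have card: "card \<Psi> \<ge> 3" by simp
      obtain A where A: "A \<in> \<Psi>" "cut_vertices \<subseteq> A"
        "\<And>B. B \<in> \<Psi> \<Longrightarrow> B \<noteq> A \<Longrightarrow> connected_coalition G A B"
        using coalition_partition_hub[OF part nf Xne card] by blast
      have "small (Y - A)" by (rule small_subset[OF small _ finite_Y]) blast
      then have "connected_dominating_set G A"
        using coalition_partition_nonempty[OF part A(1)] A(2) by (intro cdsI)
      moreover obtain B where "connected_coalition G A B"
        using coalition_partition_partner[OF part nf A(1)] .
      ultimately show False unfolding connected_coalition_def by blast
    qed
  qed
qed

text \<open>The rest \<open>?A\<close> fails because it misses two nonadjacent cycle vertices.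
  Putting one of them back amounts to deleting a single vertex of \<open>Y\<close>, which
  \<open>cds_del_Y\<close> covers.\<close>

lemma CC_eq_3:
  assumes "\<not> small Y" "card (pverts G) \<noteq> 3" "\<not> cycle_graph 4 G"
  shows "CC G = 3"
proof -
  obtain a b where ab: "a \<in> Y" "b \<in> Y" "a \<noteq> b" "(a, b) \<notin> parcs G"
    using not_small_Y_cases[OF assms(1)] assms(2) by metis
  have ba: "(b, a) \<notin> parcs G" using ab arcs_symmetric by blast
  have abC: "{a, b} \<subseteq> pverts C" using ab Y_subset by blast
  then have abV: "a \<in> pverts G" "b \<in> pverts G" using pverts_C_subset by blast+
  let ?A = "pverts G - {a, b}"
  \<comment> \<open>A third cycle vertex shows that \<open>?A\<close> is nonempty.\<close>
  have "card {a, b} < card (pverts C)" using card_pverts_C by (simp add: card_insert_if)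
  then obtain c where "c \<in> pverts C" "c \<notin> {a, b}"
    using card_mono[of "{a, b}" "pverts C"] by (metis finite.emptyI finite.insertI linorder_not_le subsetI)
  then have c: "c \<in> ?A" using pverts_C_subset by blast
  have nA: "\<not> connected_dominating_set G ?A"
    using cds_cycle_adjacent[of ?A a b] abC ab by blast
  have na: "\<not> connected_dominating_set G {a}" "\<not> connected_dominating_set G {b}"
    using ab ba abV unfolding cds_iff by blast+
  have un: "?A \<union> {a} = pverts G - {b}" "?A \<union> {b} = pverts G - {a}" using ab(3) abV by blast+
  have coal: "connected_coalition G ?A {a}" "connected_coalition G ?A {b}"
    unfolding connected_coalition_def un using nA na cds_del_Y ab abV by auto
  show ?thesis
  proof (rule CC_eqI[of G "{?A, {a}, {b}}"])
    have "partition_on (pverts G) {?A, {a}, {b}}"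
      using abV ab(3) c by (auto simp: partition_on_def disjoint_def)
    then show "connected_coalition_partition G {?A, {a}, {b}}"
      by (rule connected_coalition_partitionI)
        (use coal connected_coalition_commute[of G ?A "{a}"] connected_coalition_commute[of G ?A "{b}"]
          in \<open>elim insertE emptyE; simp\<close>)
    have "?A \<noteq> {a}" "?A \<noteq> {b}" by blast+
    then show "card {?A, {a}, {b}} = 3" using ab(3) by simp
  qed (use card_partition_le_3 assms in blast)
qed

section \<open>Graphs with at most four vertices\<close>

lemma neighbour_pair:
  assumes "v \<in> pverts C"
  obtains u w where "u \<noteq> w" "u \<noteq> v" "w \<noteq> v" "u \<in> pverts C" "w \<in> pverts C"
    "(v, u) \<in> parcs G" "(v, w) \<in> parcs G" "\<forall>z. (v, z) \<in> parcs C \<longleftrightarrow> z = u \<or> z = w"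
proof -
  obtain u w where uw: "u \<noteq> w" "{z. (v, z) \<in> parcs C} = {u, w}" using C_neighbours[OF assms] .
  then have iff: "(v, z) \<in> parcs C \<longleftrightarrow> z = u \<or> z = w" for z by blast
  then have C: "(v, u) \<in> parcs C" "(v, w) \<in> parcs C" by auto
  then have adj: "(v, u) \<in> parcs G" "(v, w) \<in> parcs G" using parcs_C_subset by blast+
  then have "u \<noteq> v" "w \<noteq> v" using no_loops' by blast+
  then show thesis using that[OF uw(1) _ _ _ _ adj] iff C parcs_C_in_pverts by blast
qed

lemma triangle_adjacent:
  assumes "m = 3" "u \<in> pverts C" "v \<in> pverts C" "u \<noteq> v"
  shows "(u, v) \<in> parcs G"
proof -
  obtain x y where xy: "x \<noteq> y" "x \<noteq> u" "y \<noteq> u" "x \<in> pverts C" "y \<in> pverts C" "(u, x) \<in> parcs G" "(u, y) \<in> parcs G"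
    using neighbour_pair[OF assms(2)] by metis
  have "{u, x, y} = pverts C"
    using xy assms card_pverts_C finite_pverts_C by (intro card_subset_eq) auto
  then have "v \<in> {u, x, y}" using assms(3) by simp
  then show ?thesis using xy(6,7) assms(4) by auto
qed

text \<open>Here every vertex is full, so the singletons form a valid partition without any
  coalition.\<close>

lemma CC_triangle:
  assumes "card (pverts G) = 3"
  shows "CC G = 3"
proof -
  have "card (pverts C) \<le> 3" using card_mono[OF pair_finite_verts pverts_C_subset] assms by simp
  then have m: "m = 3" using card_pverts_C by simp
  then have V: "pverts C = pverts G"
    using assms card_pverts_C pverts_C_subset pair_finite_verts by (intro card_subset_eq) auto
  have full: "full_vertex G v" if "v \<in> pverts G" for v
    unfolding full_vertex_iff using triangle_adjacent[OF m] that V by auto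
  let ?P = "(\<lambda>v. {v}) ` pverts G"
  show ?thesis
  proof (rule CC_eqI[of G ?P])
    have "partition_on (pverts G) ?P" by (auto simp: partition_on_def disjoint_def)
    then show "connected_coalition_partition G ?P"
      unfolding connected_coalition_partition_def using full by blast
    show "card ?P = 3" using assms by (simp add: card_image)
  next
    fix \<Psi> assume "connected_coalition_partition G \<Psi>"
    then have "partition_on (pverts G) \<Psi>" unfolding connected_coalition_partition_def by blast
    then show "card \<Psi> \<le> 3" using card_partition_on_le pair_finite_verts assms by metis
  qed
qed

text \<open>Either the vertex set is that of the cycle or one vertex hangs on a triangle. Deleting a
  vertex, other than the attachment vertex \<open>a\<close> in the latter case, leaves some vertex
  adjacent to all others, so \<open>conn_star\<close> applies.\<close>

lemma card_cut_vertices_le_1: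
  assumes "card (pverts G) \<le> 4"
  shows "card cut_vertices \<le> 1"
proof -
  have "m \<le> 4" using card_mono[OF pair_finite_verts pverts_C_subset] assms card_pverts_C by simp
  then consider (tri) "m = 3" | (quad) "m = 4" using card_pverts_C by linarith
  then have "\<exists>a. cut_vertices \<subseteq> {a}"
  proof cases
    case tri
    show ?thesis
    proof (cases "pverts G = pverts C")
      case True
      have "conn G (pverts G - {v})" if v: "v \<in> pverts G" for v
      proof -
        obtain u where u: "u \<in> pverts C" "u \<noteq> v"
          using neighbour_pair v True by metis
        show ?thesis
          by (rule conn_star[of u]) (use triangle_adjacent[OF tri] True u in auto)
      qed
      then show ?thesis unfolding cut_vertices_def by blast
    next
      case False
      then obtain l where l: "l \<in> pverts G" "l \<notin> pverts C" using pverts_C_subset by blast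
      have "insert l (pverts C) \<subseteq> pverts G" using l pverts_C_subset by blast
      moreover have "card (insert l (pverts C)) = 4" using l finite_pverts_C card_pverts_C tri by simp
      ultimately have V: "pverts G = insert l (pverts C)"
        using card_seteq[of "pverts G" "insert l (pverts C)"] pair_finite_verts assms by simp
      have "pverts C \<noteq> {}" using card_pverts_C by auto
      then obtain c where c: "c \<in> pverts C" by blast
      then have "(l, c) \<in> rtrancl_on (pverts G) (parcs G)" using connD[OF connG l(1)] pverts_C_subset by blast
      from rtrancl_on_exit[OF this, of "{l}"] c l obtain a where a: "(l, a) \<in> parcs G" "a \<in> pverts G" "a \<noteq> l"
        by blast
      then have aC: "a \<in> pverts C" using V by blast
      have adj: "(u, a) \<in> parcs G" if "u \<in> pverts G" "u \<noteq> a" for u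
        using that V a(1) triangle_adjacent[OF tri _ aC, of u] by auto
      have "conn G (pverts G - {v})" if "v \<noteq> a" for v
        by (rule conn_star[of a]) (use adj a that in auto)
      then show ?thesis unfolding cut_vertices_def by blast
    qed
  next
    case quad
    then have V: "pverts G = pverts C"
      using card_seteq[OF pair_finite_verts pverts_C_subset] assms card_pverts_C by simp
    have "conn G (pverts G - {v})" if v: "v \<in> pverts G" for v
    proof -
      have "v \<in> pverts C" using v V by simp
      then obtain u w where uw: "u \<noteq> w" "u \<noteq> v" "w \<noteq> v" "u \<in> pverts C" "w \<in> pverts C"
        "(v, u) \<in> parcs G" "(v, w) \<in> parcs G" "\<forall>z. (v, z) \<in> parcs C \<longleftrightarrow> z = u \<or> z = w"
        by (rule neighbour_pair)
      have "card {v, u, w} < card (pverts C)" using uw quad card_pverts_C by auto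
      then obtain z where z: "z \<in> pverts C" "z \<notin> {v, u, w}"
        using card_mono[of "{v, u, w}" "pverts C"] by (metis finite.emptyI finite.insertI linorder_not_le subsetI)
      then have V4: "pverts C = {v, u, w, z}"
        using uw v V quad card_pverts_C finite_pverts_C by (intro card_subset_eq[symmetric]) auto
      obtain x y where xy: "x \<noteq> y" "x \<noteq> z" "y \<noteq> z" "x \<in> pverts C" "y \<in> pverts C"
        "(z, x) \<in> parcs G" "(z, y) \<in> parcs G" "\<forall>t. (z, t) \<in> parcs C \<longleftrightarrow> t = x \<or> t = y"
        using neighbour_pair[OF z(1)] .
      \<comment> \<open>The vertex \<open>z\<close> opposite to \<open>v\<close> is no cycle
        neighbour of \<open>v\<close>, so its two cycle neighbours are \<open>u\<close> and
        \<open>w\<close>.\<close>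
      have "x \<noteq> v" "y \<noteq> v" using parcs_C_sym[of z v] uw(8) xy(8) z(2) by auto
      then have "(z, u) \<in> parcs G" "(z, w) \<in> parcs G" using xy V4 by auto
      then show ?thesis
        by (intro conn_star[of z]) (use V V4 z uw arcs_symmetric in auto)
    qed
    then show ?thesis unfolding cut_vertices_def by blast
  qed
  then obtain a where "cut_vertices \<subseteq> {a}" by blast
  then show ?thesis using card_mono[of "{a}" cut_vertices] by simp
qed

text \<open>The cycle consists of \<open>Y\<close>, with at most two vertices, and cut vertices, of
  which there is at most one; so it is a triangle \<open>a\<close>, \<open>b\<close>,
  \<open>c\<close> with \<open>c\<close> the only cut vertex. By \<open>cdsI\<close> the set
  \<open>{c}\<close> is a connected dominating set, that is, \<open>c\<close> is full.\<close>

lemma triangle_starI: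
  assumes small: "small Y" and X: "card cut_vertices \<le> 1"
  shows "triangle_star G"
proof -
  have finX: "finite cut_vertices"
    unfolding cut_vertices_def using pair_finite_verts by simp
  have "pverts C \<subseteq> Y \<union> cut_vertices" using pverts_C_cut by blast
  moreover have "card Y \<le> 2" using small unfolding small_def by blast
  moreover have "card (Y \<union> cut_vertices) \<le> card Y + card cut_vertices" by (rule card_Un_le)
  moreover have "card (pverts C) \<le> card (Y \<union> cut_vertices)"
    using calculation(1) finite_Y finX by (intro card_mono) auto
  ultimately have cards: "card Y = 2" "card cut_vertices = 1" "card (pverts C) = 3"
    and CY: "card (pverts C) = card (Y \<union> cut_vertices)"
    using card_pverts_C X by linarith+
  have C: "pverts C = Y \<union> cut_vertices"
    using card_subset_eq[OF _ \<open>pverts C \<subseteq> Y \<union> cut_vertices\<close> CY] finite_Y finX by simp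
  obtain c where c: "cut_vertices = {c}" using cards(2) by (auto simp: card_1_singleton_iff)
  obtain a b where ab: "Y = {a, b}" "a \<noteq> b" using cards(1) by (auto simp: card_2_iff)
  have abG: "(a, b) \<in> parcs G" using small ab unfolding small_def by auto
  have C': "pverts C = {a, b, c}" using C ab c by auto
  have cab: "c \<noteq> a" "c \<noteq> b" using Y_not_cut ab c by auto
  have V: "{a, b, c} \<subseteq> pverts G" using C' pverts_C_subset by simp
  have "small (Y - {c})" by (rule small_subset[OF small _ finite_Y]) blast
  then have "connected_dominating_set G {c}" using V c by (intro cdsI) auto
  then have adj: "(c, v) \<in> parcs G" if "v \<in> pverts G" "v \<noteq> c" for v
    using that unfolding cds_iff by blast
  define W where "W = pverts G - {a, b, c}"
  have finW: "finite W" unfolding W_def using pair_finite_verts by simp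
  \<comment> \<open>The star needs a leaf: without one, deleting \<open>c\<close> would leave the
    edge between \<open>a\<close> and \<open>b\<close>, and \<open>c\<close> would not be a cut
    vertex.\<close>
  have "W \<noteq> {}"
  proof
    assume "W = {}"
    then have "pverts G - {c} = {a, b}" using V cab unfolding W_def by auto
    moreover have "conn G {a, b}" by (rule conn_star[of a]) (use arcs_symmetric[OF abG] in auto)
    ultimately have "c \<notin> cut_vertices" unfolding cut_vertices_def by simp
    with c show False by simp
  qed
  define T where "T = \<lparr>pverts = {a, b, c}, parcs = {(u, v). (u, v) \<in> {a, b, c} \<times> {a, b, c} \<and> u \<noteq> v}\<rparr>"
  define S where "S = \<lparr>pverts = {c} \<union> W, parcs = {c} \<times> W \<union> W \<times> {c}\<rparr>"
  have T: "complete_digraph 3 (with_proj T)"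
    unfolding complete_digraph_pair_def T_def using cab ab(2) by auto
  have cW: "c \<notin> W" unfolding W_def by simp
  have S: "complete_bipartite_digraph 1 (card W) (with_proj S)"
    unfolding complete_bipartite_digraph_pair_def
  proof
    show "finite (pverts S)" using finW by (simp add: S_def)
    show "\<exists>U W'. pverts S = U \<union> W' \<and> U \<inter> W' = {} \<and> card U = 1 \<and> card W' = card W \<and>
        parcs S = U \<times> W' \<union> W' \<times> U"
      by (rule exI[of _ "{c}"], rule exI[of _ W]) (use cW in \<open>auto simp: S_def\<close>)
  qed
  interpret S: pair_graph S using S by (rule pair_graphI_complete_bipartite)
  have full: "full_vertex S c" unfolding S.full_vertex_iff by (auto simp: S_def)
  have int: "pverts T \<inter> pverts S = {c}" by (auto simp: T_def S_def W_def)
  \<comment> \<open>An edge avoiding the full vertex \<open>c\<close> spans a triangle with it, and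
    the only triangle is the cycle.\<close>
  have other: "{u, v} = {a, b}" if "(u, v) \<in> parcs G" "u \<noteq> c" "v \<noteq> c" for u v
  proof -
    have uv: "u \<in> pverts G" "v \<in> pverts G" using that(1) in_arcsD1 in_arcsD2 by blast+
    have "pverts C = {c, u, v}"
      using triangle_eq_C[OF adj[OF uv(1) that(2)] that(1) adj[OF uv(2) that(3)]] .
    then have "u \<in> {a, b, c}" "v \<in> {a, b, c}" unfolding C' by simp_all
    moreover have "u \<noteq> v" using that(1) by (rule no_loops')
    ultimately show ?thesis using that(2,3) by auto
  qed
  have VG: "pverts G = pverts T \<union> pverts S" using V by (auto simp: T_def S_def W_def)
  have "(u, v) \<in> parcs G \<longleftrightarrow> (u, v) \<in> parcs T \<union> parcs S" for u v
  proof
    assume uv: "(u, v) \<in> parcs G"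
    then have uvV: "u \<in> pverts G" "v \<in> pverts G" "u \<noteq> v"
      using in_arcsD1 in_arcsD2 no_loops' by blast+
    show "(u, v) \<in> parcs T \<union> parcs S"
    proof (cases "u = c \<or> v = c")
      case True
      then show ?thesis using uvV by (auto simp: T_def S_def W_def)
    next
      case False
      then have "{u, v} = {a, b}" using other uv by simp
      then have "u \<in> {a, b}" "v \<in> {a, b}" by auto
      then show ?thesis using uvV(3) by (auto simp: T_def)
    qed
  next
    have ba: "(b, a) \<in> parcs G" using abG by (rule arcs_symmetric)
    have adj': "(v, c) \<in> parcs G" if "v \<in> pverts G" "v \<noteq> c" for v
      using adj[OF that] by (rule arcs_symmetric)
    assume "(u, v) \<in> parcs T \<union> parcs S"
    then consider "u = a" "v = b" | "u = b" "v = a" | "u = c" "v \<in> pverts G" "v \<noteq> c"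
      | "v = c" "u \<in> pverts G" "u \<noteq> c"
      using V cab by (auto simp: T_def S_def W_def)
    then show "(u, v) \<in> parcs G" by cases (use abG ba adj adj' in auto)
  qed
  then have EG: "parcs G = parcs T \<union> parcs S" by auto
  have un: "with_proj G = union (with_proj T) (with_proj S)"
    using VG EG by (simp add: union_def with_proj_def)
  have "card W \<ge> 1" using \<open>W \<noteq> {}\<close> finW by (simp add: Suc_le_eq card_gt_0_iff)
  then show ?thesis unfolding triangle_star_def using T S full int un by blast
qed

text \<open>Smallness merges the two alternatives of the theorem into one condition that passes to
  subsets.\<close>

lemma small_Y_iff: "small Y \<longleftrightarrow> card Y \<le> 1 \<or> complete_digraph 2 (with_proj G \<restriction> Y)"
proof -
  have "Y \<subseteq> pverts G" using Y_subset pverts_C_subset by (rule order_trans)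
  note complete = complete_2_induce_iff[OF this]
  have "a = b" if "card Y \<le> 1" "a \<in> Y" "b \<in> Y" for a b
    using that finite_Y by (auto simp: card_le_Suc0_iff_eq)
  then have "small Y" if "card Y \<le> 1" using that unfolding small_def by auto
  moreover have "card Y \<le> 1 \<or> card Y = 2" if "small Y" using that unfolding small_def by auto
  ultimately show ?thesis using complete unfolding small_def by auto
qed

end

theorem theorem1p10:
  fixes G C :: "'a pair_pre_digraph" and m n :: nat and Y :: "'a set"
  assumes "unicycle_graph G"
    and "n = card (pverts G)"
    and "cycle_of m C G"
    and "Y = {v \<in> pverts C. connected (pre_digraph.del_vert (with_proj G) v)}"
  shows
    "(cycle_graph 4 G \<longrightarrow> CC G = 4) \<and>
     (triangle_star G \<longrightarrow> CC G = 0) \<and>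
     (\<not> triangle_star G \<and> n \<ge> 5 \<and> (card Y \<le> 1 \<or> complete_digraph 2 (with_proj G \<restriction> Y)) \<longrightarrow>
        CC G = 2) \<and>
     (\<not> cycle_graph 4 G \<and> \<not> triangle_star G \<and>
      \<not> (\<not> triangle_star G \<and> n \<ge> 5 \<and> (card Y \<le> 1 \<or> complete_digraph 2 (with_proj G \<restriction> Y))) \<longrightarrow>
        CC G = 3)"
proof -
  interpret unicycle G C m using assms(1,3) by (rule unicycleI)
  have Y: "Y = unicycle.Y G C" using assms(4) connected_del_vert_iff Y_def by simp
  have small: "(card Y \<le> 1 \<or> complete_digraph 2 (with_proj G \<restriction> Y)) \<longleftrightarrow> small (unicycle.Y G C)"
    unfolding Y using small_Y_iff by simp
  have "CC G = 0" if "triangle_star G"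
    using triangle_star_no_partition[OF that] unfolding CC_def by auto
  moreover have "CC G = 2" if "\<not> triangle_star G" "small (unicycle.Y G C)"
    using CC_eq_2[OF that(2)] triangle_starI[OF that(2)] that(1) by linarith
  moreover have "CC G = 3"
    if "\<not> cycle_graph 4 G" "\<not> triangle_star G" "\<not> (n \<ge> 5 \<and> small (unicycle.Y G C))"
  proof (cases "small (unicycle.Y G C)")
    case True
    \<comment> \<open>A small \<open>Y\<close> on at most four vertices would leave at most one cut
      vertex and so put \<open>G\<close> into the excluded family.\<close>
    then have "card (pverts G) \<le> 4" using that(3) assms(2) by simp
    then have "card cut_vertices \<le> 1" by (rule card_cut_vertices_le_1)
    then show ?thesis using triangle_starI[OF True] that(2) by simp
  next
    case False
    \<comment> \<open>The triangle is separate because its value comes from full vertices rather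
      than from nonadjacent vertices of \<open>Y\<close>.\<close>
    then show ?thesis using CC_eq_3 CC_triangle that(1) by blast
  qed
  ultimately show ?thesis unfolding small using CC_4_cycle by blast
qed

end
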